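(* Let $f_c\ge1$ be an integer, $n=2f_c+1$, $\sigma_0>0$, let $\mu^0=\sum_{j=1}^{s_0}a_j^0\delta_{t_j^0}$ with $s_0\ge1$, $a_j^0\in\mathbb C$, $t_j^0\in\mathbb T$, and observe $y=\mathcal F_n(\mu^0)+\varepsilon$. Let $0<\eta<1$ and $0<\alpha<1$ with $n>-2\log\alpha$, and let $\lambda>0$ be the tuning parameter of the CBLasso. Set $$\underline\sigma=\sqrt2\,\sigma_0\Big(1-\sqrt{-2\log\alpha/n}\Big)^{1/2},\qquad R=\sqrt{2\log(n/\alpha)/n}.$$ If $\lambda\ge(1-\eta)^{-1}R$ and $$\lambda\frac{\|\mu^0\|_{\mathrm{TV}}}{\underline\sigma}\le2\Big[\sqrt{1+(\eta/2)^2}-1\Big],$$ then $$\Big|\frac{\sqrt n\,\hat\sigma}{\|\varepsilon\|_2}-1\Big|\le\eta$$ with probability larger than $1-\alpha\Big(\frac{2\sqrt2}{n}+\frac{2\sqrt3+3}{3}\Big)$.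
   Context: $\mathbb T$ is the one-dimensional torus ($[0,1]$ with endpoints identified). $E^*=\mathcal M(\mathbb T,\mathbb C)$ is the space of complex Borel measures on $\mathbb T$ with the total variation norm $\|\mu\|_{\mathrm{TV}}=\sup_{\|f\|_\infty\le1}\mathfrak R(\int_{\mathbb T}\bar f\,d\mu)$ (supremum over continuous $f:\mathbb T\to\mathbb C$). For $n=2f_c+1$, $\mathcal F_n:E^*\to\mathbb C^n$ is $\mathcal F_n(\mu)=(c_k(\mu))_{|k|\le f_c}$, $c_k(\mu)=\int_{\mathbb T}e^{-2\pi\imath kt}\mu(dt)$. Noise: $\varepsilon=\varepsilon^{(1)}+\imath\varepsilon^{(2)}$ where $\varepsilon^{(1)},\varepsilon^{(2)}$ are i.i.d. real Gaussian vectors $\mathcal N_n(0,\sigma_0^2\mathrm{Id}_n)$. CBLasso: for $\lambda>0$ the estimator $(\hat\mu,\hat\sigma)$ is a minimizer $$(\hat\mu,\hat\sigma)\in\arg\min_{(\mu,\sigma)\in E^*\times\mathbb R_{++}}\frac1{2n\sigma}\|y-\mathcal F_n(\mu)\|_2^2+\frac\sigma2+\lambda\|\mu\|_{\mathrm{TV}},$$ where by convention the objective is replaced by its Fenchel biconjugate, i.e. it is extended to $\sigma=0$ by the value $\lambda\|\mu\|_{\mathrm{TV}}$ if $y=\mathcal F_n(\mu)$ and $+\infty$ otherwise (so $\hat\sigma\ge0$). *)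

theory Defs
  imports "HOL-Probability.Probability"
begin

text \<open>The torus as the quotient \<open>\<real>/\<int>\<close> with the quotient topology.\<close>

quotient_type torus = real / "\<lambda>x y. x - y \<in> \<int>"
  morphisms rep_torus torus_of
proof (rule equivpI)
  show "reflp (\<lambda>x y :: real. x - y \<in> \<int>)"
    by (auto intro: reflpI)
  show "symp (\<lambda>x y :: real. x - y \<in> \<int>)"
    by (rule sympI) (metis Ints_minus minus_diff_eq)
  show "transp (\<lambda>x y :: real. x - y \<in> \<int>)"
    by (rule transpI) (metis Ints_add diff_add_cancel add_diff_eq)
qed

instantiation torus :: topological_space
begin

definition open_torus :: "torus set \<Rightarrow> bool" where
  "open_torus U \<longleftrightarrow> open (torus_of -` U)"

instance
proof
  show "open (UNIV :: torus set)"
    by (simp add: open_torus_def)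
  show "open (S \<inter> T)" if "open S" "open T" for S T :: "torus set"
    using that by (simp add: open_torus_def vimage_Int open_Int)
  show "open (\<Union>K)" if "\<forall>S\<in>K. open S" for K :: "torus set set"
    using that by (simp add: open_torus_def vimage_Union open_UN)
qed

end

text \<open>Complex Borel measures are countably additive complex-valued set functions on the Borel
  sets. They are set to \<open>0\<close> off the Borel sets, so that each measure has a unique representative.\<close>

definition complex_borel_measures :: "('a::topological_space set \<Rightarrow> complex) set" where
  "complex_borel_measures = {\<mu>.
     (\<forall>A :: nat \<Rightarrow> 'a set. range A \<subseteq> sets borel \<longrightarrow> disjoint_family A \<longrightarrow>
        (\<lambda>i. \<mu> (A i)) sums \<mu> (\<Union>i. A i)) \<and>
     (\<forall>A. A \<notin> sets borel \<longrightarrow> \<mu> A = 0)}"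

text \<open>The positive part \<open>\<nu>\<^sup>+(A) = sup {\<nu>(B) | B \<subseteq> A}\<close> of the Jordan decomposition of a real signed
  measure; the negative part is the positive part of \<open>-\<nu>\<close>. Since \<open>B = {}\<close> is allowed, the truncation
  of negative values by \<^const>\<open>ennreal\<close> is harmless.\<close>

definition pos_variation :: "('a::topological_space set \<Rightarrow> real) \<Rightarrow> 'a measure" where
  "pos_variation \<nu> =
     measure_of UNIV (sets borel) (\<lambda>A. SUP B\<in>{B \<in> sets borel. B \<subseteq> A}. ennreal (\<nu> B))"

definition signed_integral ::
    "('a::topological_space set \<Rightarrow> real) \<Rightarrow> ('a \<Rightarrow> complex) \<Rightarrow> complex" where
  "signed_integral \<nu> f =
     (LINT t|pos_variation \<nu>. f t) - (LINT t|pos_variation (\<lambda>A. - \<nu> A). f t)"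

definition complex_integral ::
    "('a::topological_space set \<Rightarrow> complex) \<Rightarrow> ('a \<Rightarrow> complex) \<Rightarrow> complex" where
  "complex_integral \<mu> f =
     signed_integral (\<lambda>A. Re (\<mu> A)) f + \<i> * signed_integral (\<lambda>A. Im (\<mu> A)) f"

definition tv_norm :: "('a::topological_space set \<Rightarrow> complex) \<Rightarrow> real" where
  "tv_norm \<mu> = (SUP f\<in>{f. continuous_on UNIV f \<and> (\<forall>t. cmod (f t) \<le> 1)}.
     Re (complex_integral \<mu> (\<lambda>t. cnj (f t))))"

definition dirac :: "'a::topological_space \<Rightarrow> 'a set \<Rightarrow> complex" where
  "dirac t A = (if A \<in> sets borel then indicator A t else 0)"

lift_definition fourier_char :: "int \<Rightarrow> torus \<Rightarrow> complex"
  is "\<lambda>k t. exp (- 2 * complex_of_real pi * \<i> * of_int k * complex_of_real t)"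
proof -
  fix k :: int and s t :: real
  assume "s - t \<in> \<int>"
  then obtain m :: int where m: "s = t + of_int m"
    by (metis Ints_cases add.commute diff_add_cancel)
  have "- 2 * complex_of_real pi * \<i> * of_int k * complex_of_real s =
      - 2 * complex_of_real pi * \<i> * of_int k * complex_of_real t
      + complex_of_real (real_of_int (2 * (- k * m)) * pi) * \<i>"
    by (simp add: m algebra_simps)
  then show "exp (- 2 * complex_of_real pi * \<i> * of_int k * complex_of_real s) =
      exp (- 2 * complex_of_real pi * \<i> * of_int k * complex_of_real t)"
    unfolding exp_eq by blast
qed

definition fourier_coeff :: "(torus set \<Rightarrow> complex) \<Rightarrow> int \<Rightarrow> complex" where
  "fourier_coeff \<mu> k = complex_integral \<mu> (fourier_char k)"

text \<open>A vector in \<open>\<complex>\<^sup>n\<close>, \<open>n = 2 f\<^sub>c + 1\<close>, is a function on \<^typ>\<open>int\<close> of which only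
  the values on \<open>freqs f\<^sub>c\<close> matter.\<close>

definition freqs :: "nat \<Rightarrow> int set" where
  "freqs fc = {k. \<bar>k\<bar> \<le> int fc}"

definition l2_norm :: "nat \<Rightarrow> (int \<Rightarrow> complex) \<Rightarrow> real" where
  "l2_norm fc v = sqrt (\<Sum>k\<in>freqs fc. (cmod (v k))\<^sup>2)"

text \<open>\<open>X\<close> has law \<open>\<N>(0, s\<^sup>2 Id)\<close> on \<open>\<real>\<^sup>I\<close>.\<close>

definition isotropic_gaussian_vector ::
    "'w measure \<Rightarrow> 'i set \<Rightarrow> real \<Rightarrow> ('w \<Rightarrow> 'i \<Rightarrow> real) \<Rightarrow> bool" where
  "isotropic_gaussian_vector M I s X \<longleftrightarrow>
     X \<in> measurable M (PiM I (\<lambda>_. borel)) \<and>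
     distr M (PiM I (\<lambda>_. borel)) X = PiM I (\<lambda>_. density lborel (normal_density 0 s))"

text \<open>The objective, extended to \<open>\<sigma> = 0\<close> by its Fenchel biconjugate.\<close>

definition cblasso_objective ::
    "nat \<Rightarrow> real \<Rightarrow> (int \<Rightarrow> complex) \<Rightarrow> (torus set \<Rightarrow> complex) \<times> real \<Rightarrow> ereal" where
  "cblasso_objective fc lam y = (\<lambda>(\<mu>, \<sigma>).
     if \<sigma> > 0 then
       ereal (1 / (2 * real (2 * fc + 1) * \<sigma>) * (l2_norm fc (\<lambda>k. y k - fourier_coeff \<mu> k))\<^sup>2
              + \<sigma> / 2 + lam * tv_norm \<mu>)
     else if \<sigma> = 0 \<and> (\<forall>k\<in>freqs fc. y k = fourier_coeff \<mu> k) then ereal (lam * tv_norm \<mu>)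
     else \<infinity>)"

definition cblasso_minimizer ::
    "nat \<Rightarrow> real \<Rightarrow> (int \<Rightarrow> complex) \<Rightarrow> (torus set \<Rightarrow> complex) \<times> real \<Rightarrow> bool" where
  "cblasso_minimizer fc lam y =
     is_arg_min (cblasso_objective fc lam y) (\<lambda>(\<mu>, \<sigma>). \<mu> \<in> complex_borel_measures \<and> 0 \<le> \<sigma>)"

end

theory Submission
  imports Defs "HOL-Real_Asymp.Real_Asymp"
begin

text \<open>Minimising over \<open>\<sigma>\<close> shows that \<open>\<sigma>hat\<close> is the residual \<open>r(\<mu>hat)\<close>, where
  \<open>r(\<mu>) = \<parallel>y - F \<mu>\<parallel> / \<surd>n\<close>, and that \<open>\<mu>hat\<close> minimises \<open>r(\<mu>) + \<lambda> \<parallel>\<mu>\<parallel>\<close>. Comparison with \<open>\<mu>0\<close>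
  bounds \<open>\<sigma>hat\<close> from above. On the event that \<open>|\<Sum> \<epsilon>\<^sub>k e(k t)| \<le> R \<surd>n \<parallel>\<epsilon>\<parallel>\<close> for all \<open>t\<close>,
  projecting the residual onto \<open>\<epsilon>\<close> gives \<open>\<sigma>hat \<ge> \<parallel>\<epsilon>\<parallel> / \<surd>n - R (\<parallel>\<mu>hat\<parallel> + \<parallel>\<mu>0\<parallel>)\<close>;
  the two bounds together control \<open>\<parallel>\<mu>hat\<parallel>\<close>, and no optimality conditions are needed.

  The supremum over \<open>t\<close> is not treated by Rice's formula. A trigonometric polynomial with \<open>n\<close>
  frequencies is controlled, up to the factor \<open>N / (N - n + 1)\<close> for its square, by its values at
  \<open>N = 4 n\<close> equispaced points, and a union bound suffices because at each point
  rotation invariance gives \<open>P(|\<langle>\<epsilon>, w\<rangle>|\<^sup>2 > x \<parallel>\<epsilon>\<parallel>\<^sup>2) = (1 - x)^(n - 1)\<close> for unit vectors \<open>w\<close>. The remaining event,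
  that \<open>\<parallel>\<epsilon>\<parallel>\<close> is small, is handled by a Chernoff bound.\<close>

section \<open>Trigonometric polynomials on an equispaced grid\<close>

text \<open>Off the diagonal the sum is a geometric series with a ratio \<open>r\<close> such that
  \<open>r ^ N = 1\<close>. The bounds \<open>k < N\<close> and \<open>l < N\<close> keep
  \<open>k - l\<close> from being a nonzero multiple of \<open>N\<close>, so \<open>r\<close> is not
  1 there.\<close>

lemma sum_cis_roots:
  fixes k l N :: nat
  assumes "k < N" "l < N"
  shows "(\<Sum>j<N. cis (2 * pi * real j / real N) ^ k * cnj (cis (2 * pi * real j / real N) ^ l)) =
    (if k = l then of_nat N else 0)"
proof (cases "k = l")
  case True
  then show ?thesis by (simp add: power_mult_distrib[symmetric] cis_cnj cis_mult)
next
  case False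
  define r where "r = cis (2 * pi * ((real k - real l) / real N))"
  have N: "N > 0" using assms by simp
  have "real N * (2 * pi * ((real k - real l) / real N)) = 2 * pi * of_int (int k - int l)"
    using N by simp
  then have "r ^ N = cis (2 * pi * of_int (int k - int l))"
    unfolding r_def Complex.DeMoivre by (rule arg_cong)
  also have "\<dots> = 1" by (rule cis_multiple_2pi) simp
  finally have rN: "r ^ N = 1" .
  have "r \<noteq> 1"
  proof
    assume "r = 1"
    then have "Re r = 1" by simp
    then have "cos (2 * pi * ((real k - real l) / real N)) = 1" by (simp add: r_def)
    then obtain m :: int where "2 * pi * ((real k - real l) / real N) = of_int m * 2 * pi"
      unfolding cos_one_2pi_int by blast
    then have "(2 * pi) * ((real k - real l) / real N) = (2 * pi) * of_int m"
      by (simp only: mult_ac)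
    then have "(real k - real l) / real N = of_int m"
      by (simp only: mult_cancel_left) simp
    then have "real k - real l = of_int m * real N" using N by (simp add: field_simps)
    then have eq: "int k - int l = m * int N"
      by (metis of_int_diff of_int_eq_iff of_int_mult of_int_of_nat_eq)
    have "\<bar>int k - int l\<bar> < int N" using assms by linarith
    then have "\<bar>m\<bar> * int N < 1 * int N" using eq by (simp add: abs_mult)
    then have "m = 0" using N by (simp only: mult_less_cancel_right) linarith
    then show False using eq False by simp
  qed
  have "cis (2 * pi * real j / real N) ^ k * cnj (cis (2 * pi * real j / real N) ^ l) = r ^ j" for j
    by (simp add: r_def Complex.DeMoivre cis_cnj cis_mult algebra_simps diff_divide_distrib)
  then show ?thesis
    using False geometric_sum[OF \<open>r \<noteq> 1\<close>, of N] rN by simp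
qed

lemma poly_sum_lessThan:
  fixes p :: "'a::comm_semiring_1 poly"
  assumes "degree p < N"
  shows "poly p x = (\<Sum>k<N. coeff p k * x ^ k)"
  unfolding poly_altdef using assms by (intro sum.mono_neutral_left) (auto simp: coeff_eq_0)

text \<open>Expanding the square and summing over the grid first leaves only the diagonal terms; the
  degree bound excludes aliasing between exponents.\<close>

lemma parseval_roots_of_unity:
  fixes p :: "complex poly"
  assumes "degree p < N"
  shows "(\<Sum>j<N. (cmod (poly p (cis (2 * pi * real j / real N))))\<^sup>2) =
    real N * (\<Sum>k<N. (cmod (coeff p k))\<^sup>2)"
proof -
  define w where "w j = cis (2 * pi * real j / real N)" for j
  have "complex_of_real (\<Sum>j<N. (cmod (poly p (w j)))\<^sup>2) =
      (\<Sum>j<N. (\<Sum>k<N. coeff p k * w j ^ k) * cnj (\<Sum>l<N. coeff p l * w j ^ l))"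
    by (simp add: complex_norm_square poly_sum_lessThan[OF assms] del: cnj_sum of_real_power)
  also have "\<dots> = (\<Sum>j<N. \<Sum>k<N. \<Sum>l<N. coeff p k * cnj (coeff p l) * (w j ^ k * cnj (w j ^ l)))"
    by (simp add: sum_product mult_ac)
  also have "\<dots> = (\<Sum>k<N. \<Sum>l<N. \<Sum>j<N. coeff p k * cnj (coeff p l) * (w j ^ k * cnj (w j ^ l)))"
    by (subst sum.swap) (intro sum.cong refl sum.swap)
  also have "\<dots> = (\<Sum>k<N. \<Sum>l<N. coeff p k * cnj (coeff p l) * (if k = l then of_nat N else 0))"
    unfolding sum_distrib_left[symmetric] w_def by (intro sum.cong refl) (subst sum_cis_roots, auto)
  also have "\<dots> = complex_of_real (real N * (\<Sum>k<N. (cmod (coeff p k))\<^sup>2))"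
    by (simp add: if_distrib if_distribR sum_distrib_left complex_norm_square mult_ac del: of_real_power cong: if_cong)
  finally show ?thesis unfolding of_real_eq_iff w_def .
qed

text \<open>Cauchy-Schwarz over the \<open>N\<close> coefficients loses a factor \<open>N\<close>,
  which is exactly the normalising factor in Parseval's identity.\<close>

lemma norm_poly_le_roots_of_unity:
  fixes p :: "complex poly"
  assumes "degree p < N" "cmod z = 1"
  shows "(cmod (poly p z))\<^sup>2 \<le> (\<Sum>j<N. (cmod (poly p (cis (2 * pi * real j / real N))))\<^sup>2)"
proof -
  have "cmod (poly p z) \<le> (\<Sum>k<N. cmod (coeff p k))"
    unfolding poly_sum_lessThan[OF assms(1)]
    by (rule order_trans[OF norm_sum]) (simp add: norm_mult norm_power assms(2))
  then have "(cmod (poly p z))\<^sup>2 \<le> (\<Sum>k<N. 1 * cmod (coeff p k))\<^sup>2"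
    by (intro power_mono) auto
  also have "\<dots> \<le> (\<Sum>k<N. 1\<^sup>2) * (\<Sum>k<N. (cmod (coeff p k))\<^sup>2)"
    by (rule Cauchy_Schwarz_ineq_sum)
  finally show ?thesis by (simp add: parseval_roots_of_unity[OF assms(1)])
qed

text \<open>Multiplying \<open>p\<close> by the Dirichlet kernel \<open>q\<close> centred at \<open>z\<close> costs no aliasing as long as the degree
  stays below \<open>N\<close>, and \<open>q\<close> has a small \<open>L\<^sup>2\<close> norm compared with \<open>q(z)\<close>.\<close>

lemma norm_poly_le_oversampled_max:
  fixes p :: "complex poly"
  assumes p: "degree p < n" and "n \<le> N" and z: "cmod z = 1"
    and L: "\<And>j. j < N \<Longrightarrow> (cmod (poly p (cis (2 * pi * real j / real N))))\<^sup>2 \<le> L"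
  shows "(cmod (poly p z))\<^sup>2 \<le> real N / real (N - n + 1) * L"
proof -
  \<comment> \<open>The longest kernel for which the degree of \<open>p * q\<close>, at most
    \<open>(n - 1) + (B - 1)\<close>, still stays below \<open>N\<close>.\<close>
  define B where "B = N - n + 1"
  define q :: "complex poly" where "q = (\<Sum>j<B. monom (inverse z ^ j) j)"
  have cq: "coeff q k = (if k < B then inverse z ^ k else 0)" for k
    by (auto simp: q_def coeff_sum)
  have dq: "degree q \<le> B - 1" by (rule degree_le) (auto simp: cq)
  have "degree (p * q) \<le> degree p + degree q" by (rule degree_mult_le)
  also have "\<dots> < N" using p dq \<open>n \<le> N\<close> unfolding B_def by linarith
  finally have dpq: "degree (p * q) < N" .
  have "z \<noteq> 0" using z by auto
  then have qz: "poly q z = of_nat B"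
    by (simp add: q_def poly_sum poly_monom power_mult_distrib[symmetric])
  have B: "0 < B" "B \<le> N" using p \<open>n \<le> N\<close> by (auto simp: B_def)
  have "(\<Sum>k<N. (cmod (coeff q k))\<^sup>2) = (\<Sum>k<B. 1)"
    using B by (intro sum.mono_neutral_cong_right) (auto simp: cq norm_power norm_inverse z)
  then have sq: "(\<Sum>j<N. (cmod (poly q (cis (2 * pi * real j / real N))))\<^sup>2) = real N * real B"
    using dq B by (subst parseval_roots_of_unity) auto
  \<comment> \<open>The kernel contributes \<open>B\<^sup>2\<close> at \<open>z\<close> but only
    \<open>N * B\<close> summed over the grid; the ratio is the oversampling factor.\<close>
  have "(real B)\<^sup>2 * (cmod (poly p z))\<^sup>2 = (cmod (poly (p * q) z))\<^sup>2"
    by (simp add: qz norm_mult power_mult_distrib)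
  also have "\<dots> \<le> (\<Sum>j<N. (cmod (poly (p * q) (cis (2 * pi * real j / real N))))\<^sup>2)"
    by (rule norm_poly_le_roots_of_unity[OF dpq z])
  also have "\<dots> \<le> (\<Sum>j<N. L * (cmod (poly q (cis (2 * pi * real j / real N))))\<^sup>2)"
    by (intro sum_mono) (auto simp: norm_mult power_mult_distrib intro!: mult_right_mono L)
  also have "\<dots> = L * (real N * real B)" by (simp add: sum_distrib_left[symmetric] sq)
  finally have "real B * (real B * (cmod (poly p z))\<^sup>2) \<le> real B * (real N * L)"
    by (simp add: power2_eq_square mult_ac)
  then have "real B * (cmod (poly p z))\<^sup>2 \<le> real N * L" using B by (simp only: mult_le_cancel_left_pos of_nat_0_less_iff)
  then show ?thesis unfolding B_def[symmetric] using B by (simp add: field_simps)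
qed

section \<open>Integration against complex Borel measures\<close>

lemma complex_borel_measureD:
  assumes "\<mu> \<in> complex_borel_measures" "range A \<subseteq> sets borel" "disjoint_family A"
  shows "(\<lambda>i. \<mu> (A i)) sums \<mu> (\<Union>i. A i)"
  using assms by (auto simp: complex_borel_measures_def)

text \<open>Countable additivity along the constant sequence of empty sets makes a constant series
  summable.\<close>

lemma complex_borel_measure_empty:
  assumes "\<mu> \<in> complex_borel_measures"
  shows "\<mu> {} = 0"
proof -
  have "summable (\<lambda>i::nat. \<mu> {})"
    using complex_borel_measureD[OF assms, of "\<lambda>_. {}"] by (auto simp: disjoint_family_on_def sums_iff)
  then show ?thesis by (simp add: summable_const_iff)
qed

lemma complex_borel_measure_Un:
  assumes \<mu>: "\<mu> \<in> complex_borel_measures" and AB: "A \<in> sets borel" "B \<in> sets borel" "A \<inter> B = {}"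
  shows "\<mu> (A \<union> B) = \<mu> A + \<mu> B"
proof -
  have "(\<lambda>i. \<mu> (binaryset A B i)) sums \<mu> (A \<union> B)"
  proof -
    have "disjoint_family (binaryset A B)"
      using AB by (auto simp: disjoint_family_on_def binaryset_def)
    then show ?thesis
      using complex_borel_measureD[OF \<mu>, of "binaryset A B"] AB
      by (simp add: range_binaryset_eq UN_binaryset_eq)
  qed
  moreover have "(\<lambda>i. \<mu> (binaryset A B i)) sums (\<mu> A + \<mu> B)"
    by (rule binaryset_sums) (rule complex_borel_measure_empty[OF \<mu>])
  ultimately show ?thesis by (rule sums_unique2)
qed

text \<open>If some set had subsets of unbounded measure, one could repeatedly split off a piece of measure at
  least \<open>1\<close> in absolute value and keep such a set; the pieces contradict countable additivity.\<close>

lemma complex_borel_measure_bounded: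
  assumes \<mu>: "\<mu> \<in> complex_borel_measures"
  shows "\<exists>C. \<forall>A. cmod (\<mu> A) \<le> C"
proof (rule ccontr)
  assume contra: "\<not> ?thesis"
  define big where "big E \<longleftrightarrow> E \<in> sets borel \<and> (\<forall>C. \<exists>A\<in>sets borel. A \<subseteq> E \<and> cmod (\<mu> A) > C)" for E
  have "big UNIV" unfolding big_def
  proof safe
    fix C :: real
    \<comment> \<open>Raising the threshold to at least 0 makes \<open>\<mu> A\<close> nonzero, and
      by convention nonzero values occur only on Borel sets.\<close>
    obtain A where "cmod (\<mu> A) > max C 0" using contra not_le by blast
    moreover from this have "A \<in> sets borel" using \<mu> by (auto simp: complex_borel_measures_def)
    ultimately show "\<exists>A\<in>sets borel. A \<subseteq> UNIV \<and> cmod (\<mu> A) > C" by auto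
  qed auto
  have step: "\<exists>E'. big E' \<and> E' \<subseteq> E \<and> 1 \<le> cmod (\<mu> (E - E'))" if E: "big E" for E
  proof -
    \<comment> \<open>The margin \<open>+ 1\<close> over \<open>cmod (\<mu> E)\<close> makes both
      \<open>B\<close> and \<open>E - B\<close> have modulus at least 1, so whichever half stays
      big, the other can be split off.\<close>
    obtain B where B: "B \<in> sets borel" "B \<subseteq> E" "cmod (\<mu> B) > cmod (\<mu> E) + 1"
      using E unfolding big_def by blast
    have Es: "E \<in> sets borel" using E by (simp add: big_def)
    have split: "\<mu> A = \<mu> (A \<inter> B) + \<mu> (A \<inter> (E - B))" if "A \<in> sets borel" "A \<subseteq> E" for A
    proof -
      have "\<mu> ((A \<inter> B) \<union> (A \<inter> (E - B))) = \<mu> (A \<inter> B) + \<mu> (A \<inter> (E - B))"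
        using that B Es by (intro complex_borel_measure_Un[OF \<mu>]) auto
      moreover have "(A \<inter> B) \<union> (A \<inter> (E - B)) = A" using that by auto
      ultimately show ?thesis by simp
    qed
    have "\<mu> E = \<mu> B + \<mu> (E - B)"
      using split[OF Es] B(2) by (simp add: Int_absorb1 Int_absorb2 Diff_Int_distrib2 Int_Diff)
    then have "cmod (\<mu> B) \<le> cmod (\<mu> E) + cmod (\<mu> (E - B))"
      by (metis add_diff_cancel_right' norm_triangle_ineq4)
    then have 1: "1 \<le> cmod (\<mu> (E - B))" "1 \<le> cmod (\<mu> B)" using B(3) norm_ge_zero[of "\<mu> E"] by linarith+
    have "big B \<or> big (E - B)"
    proof (rule ccontr)
      assume "\<not> (big B \<or> big (E - B))"
      then obtain C D where C: "\<And>A. A \<in> sets borel \<Longrightarrow> A \<subseteq> B \<Longrightarrow> cmod (\<mu> A) \<le> C"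
        and D: "\<And>A. A \<in> sets borel \<Longrightarrow> A \<subseteq> E - B \<Longrightarrow> cmod (\<mu> A) \<le> D"
        using B(1) Es unfolding big_def by (meson not_less sets.Diff)
      obtain A where A: "A \<in> sets borel" "A \<subseteq> E" "cmod (\<mu> A) > C + D" using E unfolding big_def by blast
      have "cmod (\<mu> A) \<le> cmod (\<mu> (A \<inter> B)) + cmod (\<mu> (A \<inter> (E - B)))"
        unfolding split[OF A(1,2)] by (rule norm_triangle_ineq)
      also have "\<dots> \<le> C + D" using A B Es by (intro add_mono C D) auto
      finally show False using A by simp
    qed
    then show ?thesis
    proof
      assume "big B" then show ?thesis using B(2) 1 by (intro exI[of _ B]) auto
    next
      assume "big (E - B)"
      moreover have "E - (E - B) = B" using B(2) by auto
      ultimately show ?thesis using 1 by (intro exI[of _ "E - B"]) auto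
    qed
  qed
  then obtain s where s: "\<And>E. big E \<Longrightarrow> big (s E) \<and> s E \<subseteq> E \<and> 1 \<le> cmod (\<mu> (E - s E))" by metis
  define F where "F i = (s ^^ i) UNIV" for i
  have F: "big (F i)" for i by (induction i) (auto simp: F_def \<open>big UNIV\<close> s)
  have F_Suc: "F (Suc i) = s (F i)" for i by (simp add: F_def)
  have dec: "decseq F" by (rule decseq_SucI) (use s[OF F] F_Suc in auto)
  define D where "D i = F i - F (Suc i)" for i
  have "disjoint_family D" unfolding disjoint_family_on_def
  proof safe
    have *: "D i \<inter> D j = {}" if "i < j" for i j
      using decseqD[OF dec, of "Suc i" j] that by (auto simp: D_def)
    fix m n x assume "m \<noteq> n" "x \<in> D m" "x \<in> D n"
    then show "x \<in> {}" using *[of m n] *[of n m] by (cases "m < n") auto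
  qed
  moreover have "range D \<subseteq> sets borel" using F by (auto simp: D_def big_def)
  ultimately have "(\<lambda>i. \<mu> (D i)) sums \<mu> (\<Union>i. D i)" by (intro complex_borel_measureD[OF \<mu>])
  then have "(\<lambda>i. \<mu> (D i)) \<longlonglongrightarrow> 0" by (intro summable_LIMSEQ_zero) (auto simp: sums_iff)
  then obtain i where "cmod (\<mu> (D i)) < 1"
    using LIMSEQ_D[of _ 0 1] by fastforce
  then show False using s[OF F[of i]] by (simp add: D_def F_Suc)
qed

section \<open>Integrals against the Jordan parts and the total variation norm\<close>

lemma sets_pos_variation [measurable_cong, simp]: "sets (pos_variation \<nu>) = sets borel"
  unfolding pos_variation_def by (subst sets_measure_of) (auto simp: sets.sigma_sets_eq[of borel, simplified])

lemma space_pos_variation [simp]: "space (pos_variation \<nu>) = UNIV"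
  using sets_eq_imp_space_eq[OF sets_pos_variation] by simp

text \<open>Only an upper bound on the total mass is needed: if the defining set function were not a measure,
  \<^const>\<open>measure_of\<close> would yield the null measure.\<close>

lemma finite_measure_pos_variation:
  assumes "\<And>A. A \<in> sets borel \<Longrightarrow> \<nu> A \<le> C"
  shows "finite_measure (pos_variation \<nu>)"
proof (rule finite_measureI)
  have "emeasure (pos_variation \<nu>) UNIV \<le> (SUP B\<in>{B \<in> sets borel. B \<subseteq> UNIV}. ennreal (\<nu> B))"
    unfolding pos_variation_def emeasure_measure_of_conv by simp
  also have "\<dots> \<le> ennreal C" by (intro SUP_least) (auto intro!: ennreal_leI assms)
  also have "\<dots> < \<infinity>" by simp
  finally show "emeasure (pos_variation \<nu>) (space (pos_variation \<nu>)) \<noteq> \<infinity>" by simp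
qed

lemma integrable_pos_variation:
  fixes f :: "'a::topological_space \<Rightarrow> complex"
  assumes "\<And>A. A \<in> sets borel \<Longrightarrow> \<nu> A \<le> C" and f: "f \<in> borel_measurable borel" "\<And>t. cmod (f t) \<le> B"
  shows "integrable (pos_variation \<nu>) f"
proof -
  interpret finite_measure "pos_variation \<nu>" by (rule finite_measure_pos_variation[OF assms(1)])
  show ?thesis using f by (intro integrable_const_bound[where B=B]) auto
qed

context
  fixes \<mu> :: "'a::topological_space set \<Rightarrow> complex"
  assumes \<mu>: "\<mu> \<in> complex_borel_measures"
begin

lemma pos_variation_parts_integrable:
  assumes "f \<in> borel_measurable borel" "\<And>t. cmod (f t) \<le> B"
  shows "integrable (pos_variation (\<lambda>A. Re (\<mu> A))) f" "integrable (pos_variation (\<lambda>A. - Re (\<mu> A))) f"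
    "integrable (pos_variation (\<lambda>A. Im (\<mu> A))) f" "integrable (pos_variation (\<lambda>A. - Im (\<mu> A))) f"
proof -
  obtain C where C: "\<And>A. cmod (\<mu> A) \<le> C" using complex_borel_measure_bounded[OF \<mu>] by auto
  have "\<bar>Re (\<mu> A)\<bar> \<le> C" "\<bar>Im (\<mu> A)\<bar> \<le> C" for A
    using C[of A] abs_Re_le_cmod[of "\<mu> A"] abs_Im_le_cmod[of "\<mu> A"] by linarith+
  then have "Re (\<mu> A) \<le> C" "- Re (\<mu> A) \<le> C" "Im (\<mu> A) \<le> C" "- Im (\<mu> A) \<le> C" for A
    by (simp_all add: abs_le_iff)
  then show "integrable (pos_variation (\<lambda>A. Re (\<mu> A))) f" "integrable (pos_variation (\<lambda>A. - Re (\<mu> A))) f"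
    "integrable (pos_variation (\<lambda>A. Im (\<mu> A))) f" "integrable (pos_variation (\<lambda>A. - Im (\<mu> A))) f"
    using assms by (auto intro!: integrable_pos_variation[where C=C and B=B])
qed

lemma complex_integral_sum:
  assumes "\<And>k. k \<in> I \<Longrightarrow> f k \<in> borel_measurable borel"
    and "\<And>k t. k \<in> I \<Longrightarrow> cmod (f k t) \<le> B"
  shows "complex_integral \<mu> (\<lambda>t. \<Sum>k\<in>I. c k * f k t) = (\<Sum>k\<in>I. c k * complex_integral \<mu> (f k))"
proof -
  have *: "integrable (pos_variation (\<lambda>A. Re (\<mu> A))) (\<lambda>t. c k * f k t)"
     "integrable (pos_variation (\<lambda>A. - Re (\<mu> A))) (\<lambda>t. c k * f k t)"
     "integrable (pos_variation (\<lambda>A. Im (\<mu> A))) (\<lambda>t. c k * f k t)"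
     "integrable (pos_variation (\<lambda>A. - Im (\<mu> A))) (\<lambda>t. c k * f k t)" if "k \<in> I" for k
    using pos_variation_parts_integrable[OF assms(1)[OF that] assms(2)[OF that]]
    by (auto intro!: integrable_mult_right)
  show ?thesis
    unfolding complex_integral_def signed_integral_def
    by (simp add: Bochner_Integration.integral_sum * sum_subtractf sum.distrib sum_distrib_left
        algebra_simps)
qed

text \<open>\<open>tv_norm\<close> is a supremum in the reals, so it dominates its members only once
  they are known to be bounded above. The total masses of the four Jordan parts give a bound uniform
  in \<open>f\<close>.\<close>

lemma Re_complex_integral_le_tv_norm:
  assumes "continuous_on UNIV f" "\<And>t. cmod (f t) \<le> 1"
  shows "Re (complex_integral \<mu> (\<lambda>t. cnj (f t))) \<le> tv_norm \<mu>"
proof -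
  define K where "K = (\<lambda>\<nu>. measure (pos_variation \<nu>) (UNIV :: 'a set))"
  have part: "cmod (LINT t|pos_variation \<nu>. g t) \<le> K \<nu>"
    if "integrable (pos_variation \<nu>) (\<lambda>t. 1 :: complex)" "\<And>t. cmod (g t) \<le> 1" for \<nu> g
  \<comment> \<open>The split covers arbitrary \<open>g\<close>: a non-integrable one has Bochner
    integral 0 by convention.\<close>
  proof (cases "integrable (pos_variation \<nu>) g")
    case True
    have "cmod (LINT t|pos_variation \<nu>. g t) \<le> (LINT t|pos_variation \<nu>. cmod (g t))"
      by (rule integral_norm_bound)
    also have "\<dots> \<le> (LINT t|pos_variation \<nu>. 1)"
      using True that integrable_norm[OF that(1)] by (intro integral_mono) auto
    also have "\<dots> = K \<nu>" by (simp add: K_def)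
    finally show ?thesis .
  qed (simp add: not_integrable_integral_eq K_def)
  have bound: "Re (complex_integral \<mu> g) \<le> K (\<lambda>A. Re (\<mu> A)) + K (\<lambda>A. - Re (\<mu> A)) +
      (K (\<lambda>A. Im (\<mu> A)) + K (\<lambda>A. - Im (\<mu> A)))" if "\<And>t. cmod (g t) \<le> 1" for g
  proof -
    note i = pos_variation_parts_integrable[of "\<lambda>_. 1" 1, simplified]
    have "cmod (complex_integral \<mu> g) \<le> cmod (signed_integral (\<lambda>A. Re (\<mu> A)) g) + cmod (signed_integral (\<lambda>A. Im (\<mu> A)) g)"
      unfolding complex_integral_def by (rule order_trans[OF norm_triangle_ineq]) (simp add: norm_mult)
    also have "\<dots> \<le> K (\<lambda>A. Re (\<mu> A)) + K (\<lambda>A. - Re (\<mu> A)) + (K (\<lambda>A. Im (\<mu> A)) + K (\<lambda>A. - Im (\<mu> A)))"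
      unfolding signed_integral_def
      by (intro add_mono order_trans[OF norm_triangle_ineq4] part i that)
    finally show ?thesis using complex_Re_le_cmod order_trans by blast
  qed
  show ?thesis
    unfolding tv_norm_def
  proof (rule cSUP_upper)
    show "bdd_above ((\<lambda>f. Re (complex_integral \<mu> (\<lambda>t. cnj (f t)))) `
        {f. continuous_on UNIV f \<and> (\<forall>t. cmod (f t) \<le> 1)})"
      by (rule bdd_aboveI2, rule bound) simp
  qed (use assms in auto)
qed

lemma tv_norm_nonneg: "0 \<le> tv_norm \<mu>"
  using Re_complex_integral_le_tv_norm[of "\<lambda>_. 0"]
  by (simp add: complex_integral_def signed_integral_def)

text \<open>Duality: divided by \<open>B\<close>, the function in \<open>bound\<close> is an
  admissible test function for \<open>tv_norm\<close>, and its conjugate integrates to the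
  pairing.\<close>

lemma complex_integral_pairing_le:
  assumes "finite I" and "\<And>k. k \<in> I \<Longrightarrow> continuous_on UNIV (f k)"
    and "\<And>k t. k \<in> I \<Longrightarrow> cmod (f k t) \<le> 1"
    and bound: "\<And>t. cmod (\<Sum>k\<in>I. v k * cnj (f k t)) \<le> B" and "0 < B"
  shows "\<bar>\<Sum>k\<in>I. Re (cnj (v k) * complex_integral \<mu> (f k))\<bar> \<le> B * tv_norm \<mu>"
proof -
  \<comment> \<open>The sign \<open>r\<close> is taken as 1 and as -1 at the end, which gives the
    absolute value.\<close>
  have *: "r * (\<Sum>k\<in>I. Re (cnj (v k) * complex_integral \<mu> (f k))) \<le> B * tv_norm \<mu>" if r: "\<bar>r\<bar> = 1" for r
  proof -
    define g where "g t = of_real (r / B) * (\<Sum>k\<in>I. v k * cnj (f k t))" for t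
    have "continuous_on UNIV g" unfolding g_def using assms(2) by (intro continuous_intros) auto
    moreover have "cmod (g t) \<le> 1" for t
      using bound[of t] \<open>0 < B\<close> r by (simp add: g_def norm_mult norm_divide)
    ultimately have "Re (complex_integral \<mu> (\<lambda>t. cnj (g t))) \<le> tv_norm \<mu>"
      by (rule Re_complex_integral_le_tv_norm)
    also have "(\<lambda>t. cnj (g t)) = (\<lambda>t. \<Sum>k\<in>I. (of_real (r / B) * cnj (v k)) * f k t)"
      by (auto simp: g_def sum_distrib_left mult_ac)
    also have "complex_integral \<mu> \<dots> = (\<Sum>k\<in>I. (of_real (r / B) * cnj (v k)) * complex_integral \<mu> (f k))"
      using assms by (intro complex_integral_sum[where B=1] borel_measurable_continuous_onI) auto
    also have "\<dots> = of_real (r / B) * (\<Sum>k\<in>I. cnj (v k) * complex_integral \<mu> (f k))"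
      by (simp add: sum_distrib_left mult_ac)
    finally have "(r / B) * (\<Sum>k\<in>I. Re (cnj (v k) * complex_integral \<mu> (f k))) \<le> tv_norm \<mu>"
      unfolding Re_complex_of_real[symmetric] by (simp add: Re_sum)
    then show ?thesis using \<open>0 < B\<close> by (simp add: field_simps)
  qed
  show ?thesis using *[of 1] *[of "-1"] by (simp add: abs_le_iff)
qed

end

section \<open>Discrete measures and the characters of the torus\<close>

lemma sum_dirac_complex_borel_measure:
  fixes t :: "'i \<Rightarrow> 'a::topological_space"
  shows "(\<lambda>A. \<Sum>j\<in>J. a j * dirac (t j) A) \<in> complex_borel_measures"
proof -
  have "(\<lambda>i. dirac x (A i)) sums dirac x (\<Union>i. A i)"
    if A: "range A \<subseteq> sets borel" "disjoint_family A" for A :: "nat \<Rightarrow> 'a set" and x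
  proof -
    have m: "A i \<in> sets borel" for i using A(1) by auto
    show ?thesis
    proof (cases "\<exists>i. x \<in> A i")
      case True
      then obtain i where i: "x \<in> A i" by auto
      have "(\<lambda>j. if j = i then 1 else (0::complex)) sums 1" by (rule sums_single)
      moreover have "dirac x (A j) = (if j = i then 1 else 0)" for j
        using i A(2) m by (auto simp: dirac_def disjoint_family_on_def indicator_def)
      moreover have "dirac x (\<Union>i. A i) = 1" using i m by (auto simp: dirac_def indicator_def)
      ultimately show ?thesis by simp
    next
      case False
      then show ?thesis using m by (simp add: dirac_def)
    qed
  qed
  then show ?thesis
    unfolding complex_borel_measures_def
    by (auto intro!: sums_sum sums_mult simp: dirac_def)
qed

lemma fourier_char_torus_of: "fourier_char k (torus_of t) = cis (- 2 * pi * of_int k * t)"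
  by (simp add: fourier_char.abs_eq cis_conv_exp mult_ac)

lemma continuous_on_fourier_char: "continuous_on UNIV (fourier_char k)"
proof -
  \<comment> \<open>In the quotient topology, continuity is tested after composing with
    \<open>torus_of\<close>.\<close>
  have "continuous_on UNIV (\<lambda>t. fourier_char k (torus_of t))"
    unfolding fourier_char_torus_of by (intro continuous_intros)
  then show ?thesis
    by (auto simp: continuous_on_open_vimage open_torus_def vimage_comp comp_def)
qed

lemma norm_fourier_char [simp]: "cmod (fourier_char k t) = 1"
  by (induction t rule: torus.abs_induct) (simp add: fourier_char_torus_of)

section \<open>Complex Gaussian vectors\<close>

text \<open>Here \<open>s\<close> is the standard deviation of each real coordinate, so the squared
  modulus has mean \<open>2 * s\<^sup>2\<close>; this quantity recurs in all the tails
  below.\<close>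

definition complex_gaussian :: "real \<Rightarrow> complex measure" where
  "complex_gaussian s = distr (density lborel (normal_density 0 s) \<Otimes>\<^sub>M density lborel (normal_density 0 s))
     borel (\<lambda>(a, b). Complex a b)"

lemma Complex_measurable [measurable]:
  "(\<lambda>(a, b). Complex a b) \<in> borel_measurable (borel \<Otimes>\<^sub>M borel)"
  unfolding Complex_eq by measurable
lemma lborel_complex: "lborel = distr (lborel \<Otimes>\<^sub>M lborel) borel (\<lambda>(a, b). Complex a b)"
proof (rule lborel_eqI)
  fix l u :: complex
  assume *: "\<And>b. b \<in> Basis \<Longrightarrow> l \<bullet> b \<le> u \<bullet> b"
  have le: "Re l \<le> Re u" "Im l \<le> Im u"
    using *[of 1] *[of \<i>] by (auto simp: Basis_complex_def inner_complex_def)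
  have v: "(\<lambda>(a, b). Complex a b) -` box l u \<inter> space (lborel \<Otimes>\<^sub>M lborel) = {Re l<..<Re u} \<times> {Im l<..<Im u}"
    by (auto simp: box_def Basis_complex_def inner_complex_def space_pair_measure)
  have "emeasure (distr (lborel \<Otimes>\<^sub>M lborel) borel (\<lambda>(a, b). Complex a b)) (box l u) =
     emeasure (lborel \<Otimes>\<^sub>M lborel) ({Re l<..<Re u} \<times> {Im l<..<Im u})"
    unfolding v[symmetric] by (rule emeasure_distr) simp_all
  also have "\<dots> = ennreal (Re u - Re l) * ennreal (Im u - Im l)"
    using le by (subst lborel.emeasure_pair_measure_Times) simp_all
  also have "\<dots> = ennreal (\<Prod>b\<in>Basis. (u - l) \<bullet> b)"
    using le by (simp add: Basis_complex_def inner_complex_def ennreal_mult'')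
  finally show "emeasure (distr (lborel \<Otimes>\<^sub>M lborel) borel (\<lambda>(a, b). Complex a b)) (box l u) =
      ennreal (\<Prod>b\<in>Basis. (u - l) \<bullet> b)" .
qed (rule sets_distr)

lemma normal_density_mult_normal_density:
  "normal_density 0 s a * normal_density 0 s b =
   exp (- ((a\<^sup>2 + b\<^sup>2) / (2 * s\<^sup>2))) / (2 * pi * s\<^sup>2)"
proof -
  have "exp (- (a\<^sup>2 / (2 * s\<^sup>2))) * exp (- (b\<^sup>2 / (2 * s\<^sup>2))) = exp (- ((a\<^sup>2 + b\<^sup>2) / (2 * s\<^sup>2)))"
    unfolding mult_exp_exp add_divide_distrib by simp
  moreover have "sqrt (2 * pi * s\<^sup>2) * sqrt (2 * pi * s\<^sup>2) = 2 * pi * s\<^sup>2"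
    by (simp del: real_sqrt_mult)
  ultimately show ?thesis
    unfolding normal_density_def by (simp del: real_sqrt_mult)
qed

lemma prob_space_normal:
  "0 < s \<Longrightarrow> prob_space (density lborel (\<lambda>x. ennreal (normal_density 0 s x)))"
  using prob_space_normal_density[of s 0] by simp

lemma prob_space_complex_gaussian:
  assumes "0 < s"
  shows "prob_space (complex_gaussian s)"
proof -
  interpret N: prob_space "density lborel (normal_density 0 s)" by (rule prob_space_normal[OF assms])
  interpret pair_prob_space "density lborel (normal_density 0 s)" "density lborel (normal_density 0 s)" ..
  show ?thesis unfolding complex_gaussian_def by (rule prob_space_distr) simp
qed

lemma sets_complex_gaussian [measurable_cong, simp]: "sets (complex_gaussian s) = sets borel"
  by (simp add: complex_gaussian_def)

lemma space_complex_gaussian [simp]: "space (complex_gaussian s) = UNIV"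
  by (simp add: complex_gaussian_def)

text \<open>The product of two normal densities, written so that it visibly depends on
  \<open>cmod z\<close> alone; rotation invariance comes from this.\<close>

definition complex_gaussian_density :: "real \<Rightarrow> complex \<Rightarrow> real" where
  "complex_gaussian_density s z = exp (- ((cmod z)\<^sup>2 / (2 * s\<^sup>2))) / (2 * pi * s\<^sup>2)"

lemma complex_gaussian_density_measurable [measurable]:
  "complex_gaussian_density s \<in> borel_measurable borel"
  unfolding complex_gaussian_density_def by measurable

lemma complex_gaussian_density_nonneg [simp]: "0 \<le> complex_gaussian_density s z"
  by (simp add: complex_gaussian_density_def)

lemma complex_gaussian_eq_density:
  assumes "0 < s"
  shows "complex_gaussian s = density lborel (complex_gaussian_density s)"
proof -
  interpret N: prob_space "density lborel (normal_density 0 s)" by (rule prob_space_normal[OF assms])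
  have "density lborel (normal_density 0 s) \<Otimes>\<^sub>M density lborel (normal_density 0 s) =
      density (lborel \<Otimes>\<^sub>M lborel) (\<lambda>(a, b). ennreal (normal_density 0 s a) * ennreal (normal_density 0 s b))"
    by (rule pair_measure_density) (auto intro: lborel.sigma_finite_measure_axioms N.sigma_finite_measure_axioms)
  also have "\<dots> = density (lborel \<Otimes>\<^sub>M lborel) (\<lambda>x. ennreal (complex_gaussian_density s (case x of (a, b) \<Rightarrow> Complex a b)))"
    by (rule arg_cong[where f="density _"])
      (auto simp: ennreal_mult'[symmetric] normal_density_mult_normal_density complex_gaussian_density_def cmod_power2)
  finally show ?thesis
    unfolding complex_gaussian_def
    by (subst lborel_complex) (simp add: density_distr)
qed

lemma nn_integral_complex_gaussian:
  assumes "0 < s" "f \<in> borel_measurable borel"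
  shows "(\<integral>\<^sup>+z. f z \<partial>complex_gaussian s) = (\<integral>\<^sup>+z. ennreal (complex_gaussian_density s z) * f z \<partial>lborel)"
  using assms by (simp add: complex_gaussian_eq_density nn_integral_density)

text \<open>The exponential weight turns the density with parameter \<open>s\<close> into
  \<open>1 / D\<close> times the density with parameter \<open>s'\<close>, whose total mass is
  1.\<close>

lemma nn_integral_complex_gaussian_exp:
  assumes "0 < s" "0 \<le> h"
  shows "(\<integral>\<^sup>+z. ennreal (exp (- (h * (cmod z)\<^sup>2))) \<partial>complex_gaussian s) = ennreal (1 / (1 + 2 * s\<^sup>2 * h))"
proof -
  define D where "D = 1 + 2 * s\<^sup>2 * h"
  define s' where "s' = s / sqrt D"
  have D: "0 < D" using assms by (simp add: D_def add_pos_nonneg)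
  have s': "0 < s'" "s'\<^sup>2 = s\<^sup>2 / D" using D assms by (auto simp: s'_def power_divide)
  have e: "(cmod z)\<^sup>2 / (2 * s\<^sup>2) + h * (cmod z)\<^sup>2 = (cmod z)\<^sup>2 / (2 * s'\<^sup>2)" for z
    using assms(1) D unfolding s'(2) by (simp add: D_def field_simps)
  have "complex_gaussian_density s z * exp (- (h * (cmod z)\<^sup>2)) = 1 / D * complex_gaussian_density s' z" for z
  proof -
    have "complex_gaussian_density s z * exp (- (h * (cmod z)\<^sup>2)) = exp (- ((cmod z)\<^sup>2 / (2 * s\<^sup>2) + h * (cmod z)\<^sup>2)) / (2 * pi * s\<^sup>2)"
      by (simp add: complex_gaussian_density_def mult_exp_exp)
    also have "\<dots> = 1 / D * complex_gaussian_density s' z"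
      unfolding e using D by (simp add: complex_gaussian_density_def s'(2))
    finally show ?thesis .
  qed
  then have "(\<integral>\<^sup>+z. ennreal (exp (- (h * (cmod z)\<^sup>2))) \<partial>complex_gaussian s) =
      (\<integral>\<^sup>+z. ennreal (1 / D) * ennreal (complex_gaussian_density s' z) \<partial>lborel)"
    using D by (simp add: nn_integral_complex_gaussian[OF assms(1)] ennreal_mult'[symmetric])
  also have "\<dots> = ennreal (1 / D) * (\<integral>\<^sup>+z. 1 \<partial>complex_gaussian s')"
    by (simp add: nn_integral_cmult nn_integral_complex_gaussian[OF s'(1), of "\<lambda>_. 1", simplified])
  also have "(\<integral>\<^sup>+z. 1 \<partial>complex_gaussian s') = 1"
    using prob_space.emeasure_space_1[OF prob_space_complex_gaussian[OF s'(1)]] by simp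
  finally show ?thesis unfolding D_def mult_1_right .
qed

section \<open>Unitary invariance for pairs of complex Gaussians\<close>

lemma nn_integral_lborel_translate:
  fixes f :: "'a::euclidean_space \<Rightarrow> ennreal"
  assumes [measurable]: "f \<in> borel_measurable borel"
  shows "(\<integral>\<^sup>+x. f (x + c) \<partial>lborel) = (\<integral>\<^sup>+x. f x \<partial>lborel)"
proof -
  have "(\<integral>\<^sup>+x. f x \<partial>lborel) = (\<integral>\<^sup>+x. f x \<partial>distr lborel borel ((+) c))"
    by (simp only: lborel_distr_plus)
  also have "\<dots> = (\<integral>\<^sup>+x. f (c + x) \<partial>lborel)"
    by (rule nn_integral_distr) measurable
  finally show ?thesis by (simp only: add.commute)
qed

text \<open>A unitary matrix with \<open>s \<noteq> 0\<close> is a product of three shears, each of which preserves Lebesgue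
  measure by Fubini's theorem and translation invariance.\<close>

lemma nn_integral_lborel_unitary:
  fixes F :: "complex \<Rightarrow> complex \<Rightarrow> ennreal" and s :: complex and c :: real
  assumes [measurable]: "case_prod F \<in> borel_measurable (borel \<Otimes>\<^sub>M borel)"
    and cs: "c\<^sup>2 + (cmod s)\<^sup>2 = 1" and s: "s \<noteq> 0"
  shows "(\<integral>\<^sup>+u. \<integral>\<^sup>+v. F (of_real c * u - cnj s * v) (s * u + of_real c * v) \<partial>lborel \<partial>lborel) =
    (\<integral>\<^sup>+u. \<integral>\<^sup>+v. F u v \<partial>lborel \<partial>lborel)"
proof -
  have shear1: "(\<integral>\<^sup>+u. \<integral>\<^sup>+v. G (u + p * v) v \<partial>lborel \<partial>lborel) = (\<integral>\<^sup>+u. \<integral>\<^sup>+v. G u v \<partial>lborel \<partial>lborel)"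
    if [measurable]: "case_prod G \<in> borel_measurable (borel \<Otimes>\<^sub>M borel)"
    for G :: "complex \<Rightarrow> complex \<Rightarrow> ennreal" and p
  proof -
    have "(\<integral>\<^sup>+u. \<integral>\<^sup>+v. G (u + p * v) v \<partial>lborel \<partial>lborel) = (\<integral>\<^sup>+v. \<integral>\<^sup>+u. G (u + p * v) v \<partial>lborel \<partial>lborel)"
      by (rule lborel_pair.Fubini'[symmetric]) measurable
    also have "\<dots> = (\<integral>\<^sup>+v. \<integral>\<^sup>+u. G u v \<partial>lborel \<partial>lborel)"
      by (intro nn_integral_cong nn_integral_lborel_translate) measurable
    also have "\<dots> = (\<integral>\<^sup>+u. \<integral>\<^sup>+v. G u v \<partial>lborel \<partial>lborel)"
      by (rule lborel_pair.Fubini') measurable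
    finally show ?thesis .
  qed
  have shear2: "(\<integral>\<^sup>+u. \<integral>\<^sup>+v. G u (v + q * u) \<partial>lborel \<partial>lborel) = (\<integral>\<^sup>+u. \<integral>\<^sup>+v. G u v \<partial>lborel \<partial>lborel)"
    if [measurable]: "case_prod G \<in> borel_measurable (borel \<Otimes>\<^sub>M borel)"
    for G :: "complex \<Rightarrow> complex \<Rightarrow> ennreal" and q
    by (intro nn_integral_cong nn_integral_lborel_translate) measurable
  \<comment> \<open>The diagonal entry \<open>1 + p * s = c\<close> of the product of shears forces
    this \<open>p\<close>. With it the off-diagonal entry \<open>p * (2 + p * s)\<close> equals
    \<open>p * (1 + c)\<close>, and \<open>pc\<close> identifies this with \<open>- cnj s\<close> by
    means of \<open>cs\<close>.\<close>
  define p where "p = (of_real c - 1) / s"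
  have ps: "p * s = of_real c - 1" using s by (simp add: p_def)
  have "s * cnj s = of_real (1 - c\<^sup>2)" using cs complex_norm_square[of s] by (metis add_diff_cancel_left' of_real_power)
  have "s * (p * (1 + of_real c)) = s * (- cnj s)"
  proof -
    have "s * (p * (1 + of_real c)) = (p * s) * (1 + of_real c)" by (simp add: mult_ac)
    also have "\<dots> = - of_real (1 - c\<^sup>2)" unfolding ps by (simp add: algebra_simps power2_eq_square)
    finally show ?thesis using \<open>s * cnj s = of_real (1 - c\<^sup>2)\<close> by simp
  qed
  then have pc: "p * (1 + of_real c) = - cnj s" using s by (simp only: mult_cancel_left simp_thms)
  have "(\<integral>\<^sup>+u. \<integral>\<^sup>+v. F u v \<partial>lborel \<partial>lborel) = (\<integral>\<^sup>+u. \<integral>\<^sup>+v. F (u + p * v) v \<partial>lborel \<partial>lborel)"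
    by (rule shear1[symmetric]) measurable
  also have "\<dots> = (\<integral>\<^sup>+u. \<integral>\<^sup>+v. F (u + p * (v + s * u)) (v + s * u) \<partial>lborel \<partial>lborel)"
    by (rule shear2[symmetric]) measurable
  also have "\<dots> = (\<integral>\<^sup>+u. \<integral>\<^sup>+v. F ((u + p * v) + p * (v + s * (u + p * v))) (v + s * (u + p * v)) \<partial>lborel \<partial>lborel)"
    by (rule shear1[symmetric]) measurable
  also have "\<dots> = (\<integral>\<^sup>+u. \<integral>\<^sup>+v. F (of_real c * u - cnj s * v) (s * u + of_real c * v) \<partial>lborel \<partial>lborel)"
  proof (intro nn_integral_cong)
    fix u v :: complex
    have "(u + p * v) + p * (v + s * (u + p * v)) = u + (p * s) * u + p * v * (2 + p * s)" by (simp add: algebra_simps)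
    also have "\<dots> = of_real c * u + (p * (1 + of_real c)) * v" unfolding ps by (simp add: algebra_simps)
    finally have 1: "(u + p * v) + p * (v + s * (u + p * v)) = of_real c * u - cnj s * v" unfolding pc by simp
    have "v + s * (u + p * v) = s * u + (1 + p * s) * v" by (simp add: algebra_simps)
    then have 2: "v + s * (u + p * v) = s * u + c * v" unfolding ps by simp
    show "F ((u + p * v) + p * (v + s * (u + p * v))) (v + s * (u + p * v)) = F (of_real c * u - cnj s * v) (s * u + of_real c * v)"
      unfolding 1 unfolding 2 ..
  qed
  finally show ?thesis by simp
qed

lemma norm_unitary:
  fixes s u v :: complex and c :: real
  assumes "c\<^sup>2 + (cmod s)\<^sup>2 = 1"
  shows "(cmod (of_real c * u - cnj s * v))\<^sup>2 + (cmod (s * u + of_real c * v))\<^sup>2 = (cmod u)\<^sup>2 + (cmod v)\<^sup>2"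
proof -
  have "(cmod (of_real c * u - cnj s * v))\<^sup>2 + (cmod (s * u + of_real c * v))\<^sup>2 = (c\<^sup>2 + (cmod s)\<^sup>2) * ((cmod u)\<^sup>2 + (cmod v)\<^sup>2)"
    unfolding cmod_power2 by (simp add: power2_eq_square algebra_simps)
  then show ?thesis by (simp add: assms)
qed

text \<open>The form \<open>c * u + w * v\<close> is \<open>r\<close> times the first coordinate of
  a unitary image of \<open>(u, v)\<close>, and the joint density depends only on the squared norm,
  which the unitary map preserves.\<close>

lemma nn_integral_complex_gaussian_combine:
  fixes f :: "complex \<Rightarrow> real \<Rightarrow> ennreal" and w :: complex and c :: real
  assumes "0 < s" and f [measurable]: "case_prod f \<in> borel_measurable (borel \<Otimes>\<^sub>M borel)" and "0 \<le> c"
  shows "(\<integral>\<^sup>+u. \<integral>\<^sup>+v. f (of_real c * u + w * v) ((cmod u)\<^sup>2 + (cmod v)\<^sup>2) \<partial>complex_gaussian s \<partial>complex_gaussian s) =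
    (\<integral>\<^sup>+u. \<integral>\<^sup>+v. f (of_real (sqrt (c\<^sup>2 + (cmod w)\<^sup>2)) * u) ((cmod u)\<^sup>2 + (cmod v)\<^sup>2) \<partial>complex_gaussian s \<partial>complex_gaussian s)"
proof (cases "w = 0")
  \<comment> \<open>Here the root is \<open>c\<close> itself, as \<open>0 \<le> c\<close>. The
    shears used in the other case need a nonzero \<open>w\<close>.\<close>
  case True
  then show ?thesis using \<open>0 \<le> c\<close> by simp
next
  case False
  define r where "r = sqrt (c\<^sup>2 + (cmod w)\<^sup>2)"
  have r2: "r\<^sup>2 = c\<^sup>2 + (cmod w)\<^sup>2" by (simp add: r_def)
  have r: "0 < r" using False by (auto simp: r_def add_nonneg_pos)
  \<comment> \<open>The Gaussian density is absorbed into \<open>F\<close>, so that invariance of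
    Lebesgue measure applies to the whole integrand.\<close>
  define F where "F u v = f (of_real r * u) ((cmod u)\<^sup>2 + (cmod v)\<^sup>2) *
    ennreal (exp (- (((cmod u)\<^sup>2 + (cmod v)\<^sup>2) / (2 * s\<^sup>2))) / (2 * pi * s\<^sup>2)\<^sup>2)" for u v :: complex
  have Fm [measurable]: "case_prod F \<in> borel_measurable (borel \<Otimes>\<^sub>M borel)" unfolding F_def by measurable
  define s' where "s' = - cnj w / of_real r"
  define c' where "c' = c / r"
  have cs: "c'\<^sup>2 + (cmod s')\<^sup>2 = 1" using r r2[symmetric]
    by (simp add: c'_def s'_def norm_divide power_divide flip: add_divide_distrib)
  have s': "s' \<noteq> 0" using False r by (simp add: s'_def)
  have dens: "(\<integral>\<^sup>+u. \<integral>\<^sup>+v. g u v \<partial>complex_gaussian s \<partial>complex_gaussian s) =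
      (\<integral>\<^sup>+u. \<integral>\<^sup>+v. g u v * ennreal (exp (- (((cmod u)\<^sup>2 + (cmod v)\<^sup>2) / (2 * s\<^sup>2))) / (2 * pi * s\<^sup>2)\<^sup>2) \<partial>lborel \<partial>lborel)"
    if [measurable]: "case_prod g \<in> borel_measurable (borel \<Otimes>\<^sub>M borel)" for g :: "complex \<Rightarrow> complex \<Rightarrow> ennreal"
  proof -
    have *: "complex_gaussian_density s u * complex_gaussian_density s v =
       exp (- (((cmod u)\<^sup>2 + (cmod v)\<^sup>2) / (2 * s\<^sup>2))) / (2 * pi * s\<^sup>2)\<^sup>2" for u v
      by (simp add: complex_gaussian_density_def mult_exp_exp add_divide_distrib power2_eq_square)
    have "(\<integral>\<^sup>+u. \<integral>\<^sup>+v. g u v \<partial>complex_gaussian s \<partial>complex_gaussian s) =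
      (\<integral>\<^sup>+u. ennreal (complex_gaussian_density s u) * (\<integral>\<^sup>+v. ennreal (complex_gaussian_density s v) * g u v \<partial>lborel) \<partial>lborel)"
      using \<open>0 < s\<close> by (simp add: nn_integral_complex_gaussian)
    also have "\<dots> = (\<integral>\<^sup>+u. \<integral>\<^sup>+v. ennreal (complex_gaussian_density s u) * (ennreal (complex_gaussian_density s v) * g u v) \<partial>lborel \<partial>lborel)"
      by (simp add: nn_integral_cmult)
    also have "\<dots> = (\<integral>\<^sup>+u. \<integral>\<^sup>+v. g u v * ennreal (complex_gaussian_density s u * complex_gaussian_density s v) \<partial>lborel \<partial>lborel)"
      by (simp add: ennreal_mult' mult_ac)
    finally show ?thesis unfolding * .
  qed
  have arg: "of_real r * (of_real c' * u - cnj s' * v) = of_real c * u + w * v" for u v :: complex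
    using r by (simp add: c'_def s'_def algebra_simps)
  have "(\<integral>\<^sup>+u. \<integral>\<^sup>+v. f (of_real c * u + w * v) ((cmod u)\<^sup>2 + (cmod v)\<^sup>2) \<partial>complex_gaussian s \<partial>complex_gaussian s) =
      (\<integral>\<^sup>+u. \<integral>\<^sup>+v. F (of_real c' * u - cnj s' * v) (s' * u + of_real c' * v) \<partial>lborel \<partial>lborel)"
    unfolding F_def norm_unitary[OF cs] arg by (rule dens) measurable
  also have "\<dots> = (\<integral>\<^sup>+u. \<integral>\<^sup>+v. F u v \<partial>lborel \<partial>lborel)"
    using Fm cs s' by (rule nn_integral_lborel_unitary)
  also have "\<dots> = (\<integral>\<^sup>+u. \<integral>\<^sup>+v. f (of_real r * u) ((cmod u)\<^sup>2 + (cmod v)\<^sup>2) \<partial>complex_gaussian s \<partial>complex_gaussian s)"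
    unfolding F_def by (rule dens[symmetric]) measurable
  finally show ?thesis by (simp add: r_def)
qed

section \<open>The exact tail of one complex Gaussian\<close>

lemma emeasure_annulus:
  fixes r u :: real
  assumes "0 \<le> r" "r \<le> u"
  shows "emeasure lborel {z :: complex. r < (cmod z)\<^sup>2 \<and> (cmod z)\<^sup>2 \<le> u} = ennreal (pi * (u - r))"
proof -
  have sub: "cball (0::complex) (sqrt r) \<subseteq> cball 0 (sqrt u)" using assms by (intro subset_cball) simp
  have le: "(cmod z)\<^sup>2 \<le> t \<longleftrightarrow> z \<in> cball 0 (sqrt t)" if "0 \<le> t" for z t
    using that real_le_rsqrt[of "cmod z" t] real_sqrt_le_iff[of "(cmod z)\<^sup>2" t] by auto
  have "{z :: complex. r < (cmod z)\<^sup>2 \<and> (cmod z)\<^sup>2 \<le> u} = cball 0 (sqrt u) - cball 0 (sqrt r)"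
    using le[OF assms(1)] le[of u] assms by (auto simp: not_le[symmetric])
  also have "emeasure lborel \<dots> = ennreal (pi * u) - ennreal (pi * r)"
    using assms sub by (subst emeasure_Diff) (auto simp: emeasure_cball unit_ball_vol_2)
  also have "\<dots> = ennreal (pi * (u - r))"
    using assms by (simp add: ennreal_minus right_diff_distrib)
  finally show ?thesis .
qed

lemma nn_integral_exp_tail:
  fixes b t :: real
  assumes "0 < b"
  shows "(\<integral>\<^sup>+u. ennreal (exp (- (u / b)) / b) * indicator {t..} u \<partial>lborel) = ennreal (exp (- (t / b)))"
proof -
  have "(\<integral>\<^sup>+u. ennreal (exp (- (u / b)) / b) * indicator {t..} u \<partial>lborel) = 0 - (- exp (- (t / b)))"
  proof (rule nn_integral_FTC_atLeast)
    show "((\<lambda>u. - exp (- (u / b))) \<longlongrightarrow> 0) at_top" using assms by real_asymp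
    fix u :: real
    show "DERIV (\<lambda>u. - exp (- (u / b))) u :> exp (- (u / b)) / b"
      using assms by (auto intro!: derivative_eq_intros simp: field_simps)
  qed (use assms in auto)
  then show ?thesis by simp
qed

text \<open>The weight \<open>u - r\<close> is, up to the factor \<open>pi\<close>, the area of the
  annulus between the squared radii \<open>r\<close> and \<open>u\<close>.\<close>

lemma nn_integral_linear_exp_tail:
  fixes b r :: real
  assumes "0 < b"
  shows "(\<integral>\<^sup>+u. ennreal ((u - r) * (exp (- (u / b)) / b)) * indicator {r..} u \<partial>lborel) = ennreal (b * exp (- (r / b)))"
proof -
  have "(\<integral>\<^sup>+u. ennreal ((u - r) * (exp (- (u / b)) / b)) * indicator {r..} u \<partial>lborel) = 0 - (- ((r - r + b) * exp (- (r / b))))"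
  proof (rule nn_integral_FTC_atLeast[where F="\<lambda>u. - ((u - r + b) * exp (- (u / b)))"])
    show "((\<lambda>u. - ((u - r + b) * exp (- (u / b)))) \<longlongrightarrow> 0) at_top" using assms by real_asymp
    fix u :: real assume "r \<le> u"
    show "DERIV (\<lambda>u. - ((u - r + b) * exp (- (u / b)))) u :> (u - r) * (exp (- (u / b)) / b)"
      using assms by (auto intro!: derivative_eq_intros simp: field_simps)
    show "0 \<le> (u - r) * (exp (- (u / b)) / b)" using assms \<open>r \<le> u\<close> by simp
  qed auto
  then show ?thesis by simp
qed

text \<open>Layer-cake: \<open>exp (- (|z|\<^sup>2 / b))\<close> is the integral of \<open>exp (- (u / b)) / b\<close> over \<open>u \<ge> |z|\<^sup>2\<close>, and the
  resulting sections are annuli.\<close>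

lemma complex_gaussian_tail:
  assumes "0 < s" "0 \<le> r"
  shows "(\<integral>\<^sup>+z. indicator {z. r < (cmod z)\<^sup>2} z \<partial>complex_gaussian s) = ennreal (exp (- (r / (2 * s\<^sup>2))))"
proof -
  define b where "b = 2 * s\<^sup>2"
  have b: "0 < b" using assms by (simp add: b_def)
  define e where "e u = ennreal (exp (- (u / b)) / b)" for u :: real
  have [measurable]: "e \<in> borel_measurable borel" unfolding e_def by measurable
  have "(\<integral>\<^sup>+z. indicator {z. r < (cmod z)\<^sup>2} z \<partial>complex_gaussian s) =
      (\<integral>\<^sup>+z. ennreal (1 / (pi * b)) * (ennreal (exp (- ((cmod z)\<^sup>2 / b))) * indicator {z. r < (cmod z)\<^sup>2} z) \<partial>lborel)"
  proof -
    have "complex_gaussian_density s z = 1 / (pi * b) * exp (- ((cmod z)\<^sup>2 / b))" for z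
      by (simp add: complex_gaussian_density_def b_def)
    then have "ennreal (complex_gaussian_density s z) = ennreal (1 / (pi * b)) * ennreal (exp (- ((cmod z)\<^sup>2 / b)))" for z
      using b by (subst ennreal_mult'[symmetric]) simp_all
    then show ?thesis
      using assms(1) by (simp add: nn_integral_complex_gaussian mult.assoc del: nn_integral_indicator)
  qed
  also have "\<dots> = ennreal (1 / (pi * b)) * (\<integral>\<^sup>+z. ennreal (exp (- ((cmod z)\<^sup>2 / b))) * indicator {z. r < (cmod z)\<^sup>2} z \<partial>lborel)"
    by (rule nn_integral_cmult) measurable
  also have "(\<integral>\<^sup>+z. ennreal (exp (- ((cmod z)\<^sup>2 / b))) * indicator {z. r < (cmod z)\<^sup>2} z \<partial>lborel) =
      (\<integral>\<^sup>+z. \<integral>\<^sup>+u. e u * indicator {z. r < (cmod z)\<^sup>2 \<and> (cmod z)\<^sup>2 \<le> u} z \<partial>lborel \<partial>lborel)"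
  proof (rule nn_integral_cong)
    fix z :: complex
    have "ennreal (exp (- ((cmod z)\<^sup>2 / b))) * indicator {z. r < (cmod z)\<^sup>2} z =
      (\<integral>\<^sup>+u. e u * indicator {(cmod z)\<^sup>2..} u \<partial>lborel) * indicator {z. r < (cmod z)\<^sup>2} z"
      unfolding e_def nn_integral_exp_tail[OF b] ..
    also have "\<dots> = (\<integral>\<^sup>+u. e u * indicator {z. r < (cmod z)\<^sup>2 \<and> (cmod z)\<^sup>2 \<le> u} z \<partial>lborel)"
      by (subst nn_integral_multc[symmetric]) (auto intro!: nn_integral_cong split: split_indicator)
    finally show "ennreal (exp (- ((cmod z)\<^sup>2 / b))) * indicator {z. r < (cmod z)\<^sup>2} z =
      (\<integral>\<^sup>+u. e u * indicator {z. r < (cmod z)\<^sup>2 \<and> (cmod z)\<^sup>2 \<le> u} z \<partial>lborel)" .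
  qed
  also have "\<dots> = (\<integral>\<^sup>+u. \<integral>\<^sup>+z. e u * indicator {z. r < (cmod z)\<^sup>2 \<and> (cmod z)\<^sup>2 \<le> u} z \<partial>lborel \<partial>lborel)"
    by (rule lborel_pair.Fubini') measurable
  also have "\<dots> = (\<integral>\<^sup>+u. ennreal pi * (ennreal ((u - r) * (exp (- (u / b)) / b)) * indicator {r..} u) \<partial>lborel)"
  proof (rule nn_integral_cong)
    fix u :: real
    have "(\<integral>\<^sup>+z. e u * indicator {z. r < (cmod z)\<^sup>2 \<and> (cmod z)\<^sup>2 \<le> u} z \<partial>lborel) =
        e u * emeasure lborel {z :: complex. r < (cmod z)\<^sup>2 \<and> (cmod z)\<^sup>2 \<le> u}"
      by (rule nn_integral_cmult_indicator) measurable
    also have "\<dots> = ennreal pi * (ennreal ((u - r) * (exp (- (u / b)) / b)) * indicator {r..} u)"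
    proof (cases "r \<le> u")
      case True
      then show ?thesis using b
        by (simp add: emeasure_annulus[OF assms(2)] e_def ennreal_mult'[symmetric] mult_ac)
    next
      case False
      then have empty: "{z :: complex. r < (cmod z)\<^sup>2 \<and> (cmod z)\<^sup>2 \<le> u} = {}" by auto
      show ?thesis unfolding empty using False by simp
    qed
    finally show "(\<integral>\<^sup>+z. e u * indicator {z. r < (cmod z)\<^sup>2 \<and> (cmod z)\<^sup>2 \<le> u} z \<partial>lborel) =
      ennreal pi * (ennreal ((u - r) * (exp (- (u / b)) / b)) * indicator {r..} u)" .
  qed
  also have "\<dots> = ennreal pi * ennreal (b * exp (- (r / b)))"
    unfolding nn_integral_linear_exp_tail[OF b, symmetric] by (rule nn_integral_cmult) measurable
  finally show ?thesis using b by (simp add: ennreal_mult'[symmetric] b_def[symmetric])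
qed

text \<open>The logarithm of the quotient of the two sides has derivative
  \<open>- y\<^sup>2 / (1 - y)\<close>. The quadratic term is kept because it yields the Gaussian
  rate for the noise norm and makes up for the exponent \<open>card K - 1\<close> in the projection
  tail.\<close>

lemma one_minus_le_exp:
  fixes x :: real
  assumes "0 \<le> x" "x < 1"
  shows "1 - x \<le> exp (- x - x\<^sup>2 / 2)"
proof -
  have "ln (1 - x) + x + x\<^sup>2 / 2 \<le> ln (1 - 0) + 0 + 0\<^sup>2 / 2"
  proof (rule DERIV_nonpos_imp_nonincreasing[OF assms(1)])
    fix y assume y: "0 \<le> y" "y \<le> x"
    have "((\<lambda>x. ln (1 - x) + x + x\<^sup>2 / 2) has_real_derivative (- 1 / (1 - y) + 1 + y)) (at y)"
      using y assms by (auto intro!: derivative_eq_intros)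
    moreover have "- 1 / (1 - y) + 1 + y \<le> 0" using y assms by (simp add: field_simps power2_eq_square)
    ultimately show "\<exists>d. ((\<lambda>x. ln (1 - x) + x + x\<^sup>2 / 2) has_real_derivative d) (at y) \<and> d \<le> 0" by blast
  qed
  then have "exp (ln (1 - x)) \<le> exp (- x - x\<^sup>2 / 2)" by simp
  then show ?thesis using assms by simp
qed

section \<open>Linear forms and norms of complex Gaussian vectors\<close>

lemma prob_space_PiM_complex_gaussian: "0 < s \<Longrightarrow> prob_space (PiM I (\<lambda>_. complex_gaussian s))"
  by (intro prob_space_PiM prob_space_complex_gaussian)

lemma product_sigma_finite_complex_gaussian:
  "0 < s \<Longrightarrow> product_sigma_finite (\<lambda>_::'i. complex_gaussian s)"
  unfolding product_sigma_finite_def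
  by (auto intro: prob_space_imp_sigma_finite prob_space_complex_gaussian)

text \<open>Moving \<open>x\<close> outermost leaves the pair \<open>u\<close>, \<open>v\<close>
  innermost, where a two-coordinate rotation can act with \<open>x\<close> fixed.\<close>

lemma nn_integral_rotate3:
  assumes s: "sigma_finite_measure L" "sigma_finite_measure N"
    and h: "(\<lambda>(v, u, x). h v u x) \<in> borel_measurable (L \<Otimes>\<^sub>M L \<Otimes>\<^sub>M N)"
  shows "(\<integral>\<^sup>+v. \<integral>\<^sup>+u. \<integral>\<^sup>+x. h v u x \<partial>N \<partial>L \<partial>L) = (\<integral>\<^sup>+x. \<integral>\<^sup>+u. \<integral>\<^sup>+v. h v u x \<partial>L \<partial>L \<partial>N)"
proof -
  interpret L: sigma_finite_measure L by (rule s)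
  interpret N: sigma_finite_measure N by (rule s)
  interpret LL: pair_sigma_finite L L ..
  interpret LN: pair_sigma_finite L N ..
  define H where "H = (\<lambda>(v, u, x). h v u x)"
  have [measurable]: "H \<in> borel_measurable (L \<Otimes>\<^sub>M L \<Otimes>\<^sub>M N)" unfolding H_def by (rule h)
  have hH: "h v u x = H (v, u, x)" for v u x by (simp add: H_def)
  have "(\<integral>\<^sup>+v. \<integral>\<^sup>+u. \<integral>\<^sup>+x. H (v, u, x) \<partial>N \<partial>L \<partial>L) = (\<integral>\<^sup>+v. \<integral>\<^sup>+x. \<integral>\<^sup>+u. H (v, u, x) \<partial>L \<partial>N \<partial>L)"
    by (intro nn_integral_cong LN.Fubini'[symmetric]) measurable
  also have "\<dots> = (\<integral>\<^sup>+x. \<integral>\<^sup>+v. \<integral>\<^sup>+u. H (v, u, x) \<partial>L \<partial>L \<partial>N)"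
    by (rule LN.Fubini'[symmetric]) measurable
  also have "\<dots> = (\<integral>\<^sup>+x. \<integral>\<^sup>+u. \<integral>\<^sup>+v. H (v, u, x) \<partial>L \<partial>L \<partial>N)"
    by (intro nn_integral_cong LL.Fubini') measurable
  finally show ?thesis unfolding hH .
qed

text \<open>Rotations of pairs of coordinates turn the linear form into a multiple of a single coordinate
  without changing the squared norm; the extra coordinate \<open>u\<close> starts the induction.\<close>

lemma nn_integral_gaussian_linear_form:
  fixes f :: "complex \<Rightarrow> real \<Rightarrow> ennreal" and w :: "'i \<Rightarrow> complex"
  assumes s: "0 < s" and "finite I" and "0 \<le> c"
    and "case_prod f \<in> borel_measurable (borel \<Otimes>\<^sub>M borel)"
  shows "(\<integral>\<^sup>+u. \<integral>\<^sup>+x. f (of_real c * u + (\<Sum>k\<in>I. w k * x k)) ((cmod u)\<^sup>2 + (\<Sum>k\<in>I. (cmod (x k))\<^sup>2))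
      \<partial>PiM I (\<lambda>_. complex_gaussian s) \<partial>complex_gaussian s) =
    (\<integral>\<^sup>+u. \<integral>\<^sup>+x. f (of_real (sqrt (c\<^sup>2 + (\<Sum>k\<in>I. (cmod (w k))\<^sup>2))) * u) ((cmod u)\<^sup>2 + (\<Sum>k\<in>I. (cmod (x k))\<^sup>2))
      \<partial>PiM I (\<lambda>_. complex_gaussian s) \<partial>complex_gaussian s)"
  using assms(2-)
proof (induction I arbitrary: c f rule: finite_induct)
  case empty
  then show ?case by simp
next
  case (insert i I)
  note insert.prems(2) [measurable] and [simp] = insert.hyps(1)
  let ?G = "complex_gaussian s"
  let ?P = "PiM I (\<lambda>_. complex_gaussian s)"
  define S where "S x = (\<Sum>k\<in>I. w k * x k)" for x
  define Q where "Q x = (\<Sum>k\<in>I. (cmod (x k))\<^sup>2)" for x :: "'i \<Rightarrow> complex"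
  have [measurable]: "S \<in> borel_measurable ?P" unfolding S_def by measurable
  have [measurable]: "Q \<in> borel_measurable ?P" unfolding Q_def by measurable
  interpret G: prob_space ?G by (rule prob_space_complex_gaussian[OF s])
  interpret P: prob_space ?P by (rule prob_space_PiM_complex_gaussian[OF s])
  interpret GG: pair_sigma_finite ?G ?G ..
  interpret product_sigma_finite "\<lambda>_::'i. ?G" by (rule product_sigma_finite_complex_gaussian[OF s])
  have upd: "(\<Sum>k\<in>insert i I. w k * (x(i := v)) k) = w i * v + S x"
    "(\<Sum>k\<in>insert i I. (cmod ((x(i := v)) k))\<^sup>2) = (cmod v)\<^sup>2 + Q x" for x v
    using insert.hyps by (auto simp: S_def Q_def intro!: sum.cong)
  define c' where "c' = sqrt (c\<^sup>2 + (cmod (w i))\<^sup>2)"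
  have c': "0 \<le> c'" "sqrt (c'\<^sup>2 + (\<Sum>k\<in>I. (cmod (w k))\<^sup>2)) = sqrt (c\<^sup>2 + (\<Sum>k\<in>insert i I. (cmod (w k))\<^sup>2))"
    using insert.hyps by (simp_all add: c'_def add.assoc)
  \<comment> \<open>Coordinate \<open>i\<close> is peeled off as \<open>v\<close> and moved
    outermost; this is used forwards at the start of the chain and backwards at its end.\<close>
  have expand: "(\<integral>\<^sup>+u. \<integral>\<^sup>+x. g u (\<Sum>k\<in>insert i I. w k * x k) (\<Sum>k\<in>insert i I. (cmod (x k))\<^sup>2)
      \<partial>PiM (insert i I) (\<lambda>_. ?G) \<partial>?G) = (\<integral>\<^sup>+v. \<integral>\<^sup>+u. \<integral>\<^sup>+x. g u (w i * v + S x) ((cmod v)\<^sup>2 + Q x) \<partial>?P \<partial>?G \<partial>?G)"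
    if g: "(\<lambda>(u, a, q). g u a q) \<in> borel_measurable (borel \<Otimes>\<^sub>M borel \<Otimes>\<^sub>M borel)"
    for g :: "complex \<Rightarrow> complex \<Rightarrow> real \<Rightarrow> ennreal"
  proof -
    define H where "H = (\<lambda>(u, a, q). g u a q)"
    have [measurable]: "H \<in> borel_measurable (borel \<Otimes>\<^sub>M borel \<Otimes>\<^sub>M borel)" unfolding H_def by (rule g)
    have hH: "g u a q = H (u, a, q)" for u a q by (simp add: H_def)
    have "(\<integral>\<^sup>+u. \<integral>\<^sup>+x. H (u, \<Sum>k\<in>insert i I. w k * x k, \<Sum>k\<in>insert i I. (cmod (x k))\<^sup>2)
        \<partial>PiM (insert i I) (\<lambda>_. ?G) \<partial>?G) =
      (\<integral>\<^sup>+u. \<integral>\<^sup>+v. \<integral>\<^sup>+x. H (u, w i * v + S x, (cmod v)\<^sup>2 + Q x) \<partial>?P \<partial>?G \<partial>?G)"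
      unfolding upd[symmetric]
      by (intro nn_integral_cong product_nn_integral_insert_rev insert.hyps) measurable
    also have "\<dots> = (\<integral>\<^sup>+v. \<integral>\<^sup>+u. \<integral>\<^sup>+x. H (u, w i * v + S x, (cmod v)\<^sup>2 + Q x) \<partial>?P \<partial>?G \<partial>?G)"
      by (rule GG.Fubini') measurable
    finally show ?thesis unfolding hH .
  qed
  have "(\<integral>\<^sup>+u. \<integral>\<^sup>+x. f (of_real c * u + (\<Sum>k\<in>insert i I. w k * x k)) ((cmod u)\<^sup>2 + (\<Sum>k\<in>insert i I. (cmod (x k))\<^sup>2))
      \<partial>PiM (insert i I) (\<lambda>_. ?G) \<partial>?G) =
      (\<integral>\<^sup>+v. \<integral>\<^sup>+u. \<integral>\<^sup>+x. f (of_real c * u + (w i * v + S x)) ((cmod u)\<^sup>2 + ((cmod v)\<^sup>2 + Q x)) \<partial>?P \<partial>?G \<partial>?G)"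
    by (rule expand) measurable
  also have "\<dots> = (\<integral>\<^sup>+x. \<integral>\<^sup>+u. \<integral>\<^sup>+v. f (of_real c * u + (w i * v + S x)) ((cmod u)\<^sup>2 + ((cmod v)\<^sup>2 + Q x)) \<partial>?G \<partial>?G \<partial>?P)"
    by (intro nn_integral_rotate3 G.sigma_finite_measure_axioms P.sigma_finite_measure_axioms) measurable
  \<comment> \<open>The rotation merges \<open>w i * v\<close> into the \<open>u\<close> term, whose
    coefficient grows from \<open>c\<close> to \<open>c'\<close>.\<close>
  also have "\<dots> = (\<integral>\<^sup>+x. \<integral>\<^sup>+u. \<integral>\<^sup>+v. f (of_real c' * u + S x) ((cmod u)\<^sup>2 + ((cmod v)\<^sup>2 + Q x)) \<partial>?G \<partial>?G \<partial>?P)"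
    unfolding c'_def add.assoc[symmetric]
    by (intro nn_integral_cong nn_integral_complex_gaussian_combine[OF s _ insert.prems(1)]) measurable
  also have "\<dots> = (\<integral>\<^sup>+v. \<integral>\<^sup>+u. \<integral>\<^sup>+x. f (of_real c' * u + S x) ((cmod u)\<^sup>2 + ((cmod v)\<^sup>2 + Q x)) \<partial>?P \<partial>?G \<partial>?G)"
    by (intro nn_integral_rotate3[symmetric] G.sigma_finite_measure_axioms P.sigma_finite_measure_axioms) measurable
  also have "\<dots> = (\<integral>\<^sup>+v. \<integral>\<^sup>+u. \<integral>\<^sup>+x. f (of_real c' * u + S x) ((cmod v)\<^sup>2 + ((cmod u)\<^sup>2 + Q x)) \<partial>?P \<partial>?G \<partial>?G)"
    by (simp only: add.left_commute)
  \<comment> \<open>The induction hypothesis is applied for each fixed \<open>v\<close>, to a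
    function that absorbs \<open>(cmod v)\<^sup>2\<close> into its second argument; hence the
    generalisation over \<open>f\<close>.\<close>
  also have "\<dots> = (\<integral>\<^sup>+v. \<integral>\<^sup>+u. \<integral>\<^sup>+x. f (of_real (sqrt (c'\<^sup>2 + (\<Sum>k\<in>I. (cmod (w k))\<^sup>2))) * u)
      ((cmod v)\<^sup>2 + ((cmod u)\<^sup>2 + Q x)) \<partial>?P \<partial>?G \<partial>?G)"
    unfolding S_def Q_def
    by (intro nn_integral_cong insert.IH[of c' "\<lambda>a q. f a ((cmod v)\<^sup>2 + q)" for v] c') measurable
  also have "\<dots> = (\<integral>\<^sup>+v. \<integral>\<^sup>+u. \<integral>\<^sup>+x. f (of_real (sqrt (c\<^sup>2 + (\<Sum>k\<in>insert i I. (cmod (w k))\<^sup>2))) * u)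
      ((cmod u)\<^sup>2 + ((cmod v)\<^sup>2 + Q x)) \<partial>?P \<partial>?G \<partial>?G)"
    unfolding c' by (simp only: add.left_commute)
  also have "\<dots> = (\<integral>\<^sup>+u. \<integral>\<^sup>+x. f (of_real (sqrt (c\<^sup>2 + (\<Sum>k\<in>insert i I. (cmod (w k))\<^sup>2))) * u)
      ((cmod u)\<^sup>2 + (\<Sum>k\<in>insert i I. (cmod (x k))\<^sup>2)) \<partial>PiM (insert i I) (\<lambda>_. ?G) \<partial>?G)"
    by (rule expand[symmetric]) measurable
  finally show ?case .
qed

lemma nn_integral_exp_norm_square:
  assumes s: "0 < s" and I: "finite I" and h: "0 \<le> h"
  shows "(\<integral>\<^sup>+x. ennreal (exp (- (h * (\<Sum>k\<in>I. (cmod (x k))\<^sup>2)))) \<partial>PiM I (\<lambda>_. complex_gaussian s)) =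
    ennreal ((1 / (1 + 2 * s\<^sup>2 * h)) ^ card I)"
proof -
  interpret product_sigma_finite "\<lambda>_. complex_gaussian s" by (rule product_sigma_finite_complex_gaussian[OF s])
  have "(\<integral>\<^sup>+x. ennreal (exp (- (h * (\<Sum>k\<in>I. (cmod (x k))\<^sup>2)))) \<partial>PiM I (\<lambda>_. complex_gaussian s)) =
      (\<integral>\<^sup>+x. (\<Prod>k\<in>I. ennreal (exp (- (h * (cmod (x k))\<^sup>2)))) \<partial>PiM I (\<lambda>_. complex_gaussian s))"
    using I by (simp add: prod_ennreal exp_sum[symmetric] sum_negf sum_distrib_left)
  also have "\<dots> = (\<Prod>k\<in>I. ennreal (1 / (1 + 2 * s\<^sup>2 * h)))"
    using I by (subst product_nn_integral_prod) (auto simp: nn_integral_complex_gaussian_exp[OF s h])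
  finally show ?thesis using h by (simp add: ennreal_power)
qed

text \<open>By rotation the form becomes one coordinate \<open>u\<close>. Given the remaining
  squared norm \<open>Q\<close>, the event has probability \<open>exp (- (h * Q))\<close> by the
  exact tail, and the Laplace transform of \<open>Q\<close> gives the power. The real coefficient
  \<open>w k0\<close> lets \<open>k0\<close> act as the extra coordinate of
  \<open>nn_integral_gaussian_linear_form\<close>.\<close>

lemma gaussian_projection_tail:
  fixes w :: "'i \<Rightarrow> complex"
  assumes s: "0 < s" and K: "finite K" "k0 \<in> K" and w: "w k0 = of_real c" "0 \<le> c" "(\<Sum>k\<in>K. (cmod (w k))\<^sup>2) = 1"
    and x: "0 \<le> x" "x < 1"
  shows "(\<integral>\<^sup>+z. indicator {z. x * (\<Sum>k\<in>K. (cmod (z k))\<^sup>2) < (cmod (\<Sum>k\<in>K. w k * z k))\<^sup>2} z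
      \<partial>PiM K (\<lambda>_. complex_gaussian s)) = ennreal ((1 - x) ^ (card K - 1))"
proof -
  define I where "I = K - {k0}"
  have I: "finite I" "k0 \<notin> I" "K = insert k0 I" using K by (auto simp: I_def)
  let ?G = "complex_gaussian s"
  let ?P = "PiM I (\<lambda>_. complex_gaussian s)"
  interpret G: prob_space ?G by (rule prob_space_complex_gaussian[OF s])
  interpret P: prob_space ?P by (rule prob_space_PiM_complex_gaussian[OF s])
  interpret GP: pair_sigma_finite ?G ?P ..
  interpret product_sigma_finite "\<lambda>_::'i. ?G" by (rule product_sigma_finite_complex_gaussian[OF s])
  define f :: "complex \<Rightarrow> real \<Rightarrow> ennreal" where "f a q = indicator {(a, q). x * q < (cmod a)\<^sup>2} (a, q)" for a q
  have [measurable]: "case_prod f \<in> borel_measurable (borel \<Otimes>\<^sub>M borel)"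
    unfolding f_def by measurable
  define Q where "Q z = (\<Sum>k\<in>I. (cmod (z k))\<^sup>2)" for z :: "'i \<Rightarrow> complex"
  have [measurable]: "Q \<in> borel_measurable ?P" unfolding Q_def using I(1) by measurable
  have Q0: "0 \<le> Q z" for z by (simp add: Q_def sum_nonneg)
  \<comment> \<open>The tail of \<open>u\<close> at level \<open>x / (1 - x) * Q\<close> has this
    rate, and \<open>1 + 2 * s\<^sup>2 * h = 1 / (1 - x)\<close>.\<close>
  define h where "h = x / (1 - x) / (2 * s\<^sup>2)"
  have h: "0 \<le> h" using x by (simp add: h_def)
  have upd: "(\<Sum>k\<in>insert k0 I. w k * (z(k0 := u)) k) = of_real c * u + (\<Sum>k\<in>I. w k * z k)"
    "(\<Sum>k\<in>insert k0 I. (cmod ((z(k0 := u)) k))\<^sup>2) = (cmod u)\<^sup>2 + (\<Sum>k\<in>I. (cmod (z k))\<^sup>2)" for z u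
    using I w(1) by (auto intro!: sum.cong)
  have one: "sqrt (c\<^sup>2 + (\<Sum>k\<in>I. (cmod (w k))\<^sup>2)) = 1"
    using w I by simp
  have "(\<integral>\<^sup>+z. indicator {z. x * (\<Sum>k\<in>K. (cmod (z k))\<^sup>2) < (cmod (\<Sum>k\<in>K. w k * z k))\<^sup>2} z
      \<partial>PiM K (\<lambda>_. ?G)) = (\<integral>\<^sup>+z. f (\<Sum>k\<in>K. w k * z k) (\<Sum>k\<in>K. (cmod (z k))\<^sup>2) \<partial>PiM K (\<lambda>_. ?G))"
    by (auto simp: f_def intro!: nn_integral_cong split: split_indicator)
  also have "\<dots> = (\<integral>\<^sup>+u. \<integral>\<^sup>+z. f (of_real c * u + (\<Sum>k\<in>I. w k * z k)) ((cmod u)\<^sup>2 + (\<Sum>k\<in>I. (cmod (z k))\<^sup>2)) \<partial>?P \<partial>?G)"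
    unfolding I(3) upd[symmetric] using I by (intro product_nn_integral_insert_rev) auto
  also have "\<dots> = (\<integral>\<^sup>+u. \<integral>\<^sup>+z. f (of_real 1 * u) ((cmod u)\<^sup>2 + (\<Sum>k\<in>I. (cmod (z k))\<^sup>2)) \<partial>?P \<partial>?G)"
    unfolding one[symmetric] by (rule nn_integral_gaussian_linear_form) (use s I w in auto)
  also have "\<dots> = (\<integral>\<^sup>+u. \<integral>\<^sup>+z. f u ((cmod u)\<^sup>2 + Q z) \<partial>?P \<partial>?G)" by (simp add: Q_def)
  also have "\<dots> = (\<integral>\<^sup>+z. \<integral>\<^sup>+u. f u ((cmod u)\<^sup>2 + Q z) \<partial>?G \<partial>?P)"
    by (rule GP.Fubini'[symmetric]) measurable
  also have "\<dots> = (\<integral>\<^sup>+z. ennreal (exp (- (h * Q z))) \<partial>?P)"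
  proof (rule nn_integral_cong)
    fix z
    have iff: "x * ((cmod u)\<^sup>2 + Q z) < (cmod u)\<^sup>2 \<longleftrightarrow> x / (1 - x) * Q z < (cmod u)\<^sup>2" for u
      using x by (simp add: field_simps)
    have "(\<integral>\<^sup>+u. f u ((cmod u)\<^sup>2 + Q z) \<partial>?G) = (\<integral>\<^sup>+u. indicator {u. x / (1 - x) * Q z < (cmod u)\<^sup>2} u \<partial>?G)"
      unfolding f_def indicator_def mem_Collect_eq prod.case iff ..
    also have "\<dots> = ennreal (exp (- (x / (1 - x) * Q z / (2 * s\<^sup>2))))"
      using s x Q0[of z] by (intro complex_gaussian_tail) auto
    finally show "(\<integral>\<^sup>+u. f u ((cmod u)\<^sup>2 + Q z) \<partial>?G) = ennreal (exp (- (h * Q z)))" by (simp add: h_def)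
  qed
  also have "\<dots> = ennreal ((1 / (1 + 2 * s\<^sup>2 * h)) ^ card I)"
    unfolding Q_def by (rule nn_integral_exp_norm_square[OF s I(1) h])
  also have "1 / (1 + 2 * s\<^sup>2 * h) = 1 - x"
    using x s by (simp add: h_def field_simps)
  also have "card I = card K - 1" using K by (simp add: I_def)
  finally show ?thesis .
qed

text \<open>With \<open>n = card K\<close>, the exponent \<open>n - 1\<close> lacks one factor
  \<open>exp (- x)\<close>. It is recovered from the quadratic term, since
  \<open>(n - 1) * x\<^sup>2 / 2 \<ge> x\<close> under the last hypothesis.\<close>

lemma gaussian_projection_tail_le_exp:
  fixes w :: "'i \<Rightarrow> complex"
  assumes s: "0 < s" and K: "finite K" "k0 \<in> K" and w: "w k0 = of_real c" "0 \<le> c" "(\<Sum>k\<in>K. (cmod (w k))\<^sup>2) = 1"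
    and x: "2 \<le> x * (real (card K) - 1)"
  shows "(\<integral>\<^sup>+z. indicator {z. x * (\<Sum>k\<in>K. (cmod (z k))\<^sup>2) < (cmod (\<Sum>k\<in>K. w k * z k))\<^sup>2} z
      \<partial>PiM K (\<lambda>_. complex_gaussian s)) \<le> ennreal (exp (- real (card K) * x))"
proof -
  have K1: "1 \<le> card K" using K by (simp add: Suc_le_eq card_gt_0_iff) auto
  have "0 < x * (real (card K) - 1)" using x by simp
  then have x0: "0 \<le> x" using K1 by (simp add: zero_less_mult_iff)
  show ?thesis
  proof (cases "x < 1")
    case True
    have "(1 - x) ^ (card K - 1) \<le> exp (- x - x\<^sup>2 / 2) ^ (card K - 1)"
      using True by (intro power_mono one_minus_le_exp x0) auto
    also have "\<dots> = exp ((real (card K) - 1) * (- x - x\<^sup>2 / 2))"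
      using K1 by (simp add: exp_of_nat_mult[symmetric] of_nat_diff)
    also have "\<dots> \<le> exp (- real (card K) * x)"
    proof -
      have "2 * x \<le> x * (real (card K) - 1) * x" using x x0 by (rule mult_right_mono)
      then show ?thesis by (simp add: algebra_simps power2_eq_square)
    qed
    finally show ?thesis
      unfolding gaussian_projection_tail[OF s K w x0 True] by (rule ennreal_leI)
  next
    \<comment> \<open>For \<open>x \<ge> 1\<close> the event is empty by Cauchy-Schwarz.\<close>
    case False
    have "(cmod (\<Sum>k\<in>K. w k * z k))\<^sup>2 \<le> x * (\<Sum>k\<in>K. (cmod (z k))\<^sup>2)" for z
    proof -
      have "(cmod (\<Sum>k\<in>K. w k * z k))\<^sup>2 \<le> (\<Sum>k\<in>K. cmod (w k) * cmod (z k))\<^sup>2"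
        by (intro power_mono order_trans[OF norm_sum]) (auto simp: norm_mult)
      also have "\<dots> \<le> (\<Sum>k\<in>K. (cmod (w k))\<^sup>2) * (\<Sum>k\<in>K. (cmod (z k))\<^sup>2)"
        by (rule Cauchy_Schwarz_ineq_sum)
      also have "\<dots> \<le> x * (\<Sum>k\<in>K. (cmod (z k))\<^sup>2)"
        unfolding w using False by (intro mult_right_mono) (auto simp: sum_nonneg)
      finally show ?thesis .
    qed
    then have "{z. x * (\<Sum>k\<in>K. (cmod (z k))\<^sup>2) < (cmod (\<Sum>k\<in>K. w k * z k))\<^sup>2} = {}"
      by (auto simp: not_less)
    then show ?thesis by simp
  qed
qed

text \<open>A Chernoff bound below the mean \<open>2 * s\<^sup>2 * card K\<close>, using the Laplace
  transform of the squared norm.\<close>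

lemma gaussian_norm_lower_tail:
  assumes s: "0 < s" and K: "finite K" and d: "0 \<le> d" "d < 1"
  shows "(\<integral>\<^sup>+z. indicator {z. (\<Sum>k\<in>K. (cmod (z k))\<^sup>2) < 2 * s\<^sup>2 * real (card K) * (1 - d)} z
      \<partial>PiM K (\<lambda>_. complex_gaussian s)) \<le> ennreal (exp (- real (card K) * d\<^sup>2 / 2))"
proof -
  \<comment> \<open>The optimal Chernoff parameter: it solves
    \<open>1 + 2 * s\<^sup>2 * h = 1 / (1 - d)\<close> and leaves the bound
    \<open>(exp d * (1 - d)) ^ card K\<close>.\<close>
  define h where "h = d / (1 - d) / (2 * s\<^sup>2)"
  have h: "0 \<le> h" using d by (simp add: h_def)
  have h1: "h * (2 * s\<^sup>2 * real (card K) * (1 - d)) = real (card K) * d"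
    using s d by (simp add: h_def)
  have h2: "1 / (1 + 2 * s\<^sup>2 * h) = 1 - d"
    using d s by (simp add: h_def field_simps)
  have "(\<integral>\<^sup>+z. indicator {z. (\<Sum>k\<in>K. (cmod (z k))\<^sup>2) < 2 * s\<^sup>2 * real (card K) * (1 - d)} z
      \<partial>PiM K (\<lambda>_. complex_gaussian s)) \<le>
     (\<integral>\<^sup>+z. ennreal (exp (real (card K) * d)) * ennreal (exp (- (h * (\<Sum>k\<in>K. (cmod (z k))\<^sup>2)))) \<partial>PiM K (\<lambda>_. complex_gaussian s))"
  proof (rule nn_integral_mono)
    fix z :: "'a \<Rightarrow> complex"
    show "indicator {z. (\<Sum>k\<in>K. (cmod (z k))\<^sup>2) < 2 * s\<^sup>2 * real (card K) * (1 - d)} z \<le>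
      ennreal (exp (real (card K) * d)) * ennreal (exp (- (h * (\<Sum>k\<in>K. (cmod (z k))\<^sup>2))))"
    proof (cases "(\<Sum>k\<in>K. (cmod (z k))\<^sup>2) < 2 * s\<^sup>2 * real (card K) * (1 - d)")
      case True
      then have "h * (\<Sum>k\<in>K. (cmod (z k))\<^sup>2) \<le> real (card K) * d"
        unfolding h1[symmetric] by (intro mult_left_mono h) auto
      then have "1 \<le> exp (real (card K) * d) * exp (- (h * (\<Sum>k\<in>K. (cmod (z k))\<^sup>2)))"
        by (simp add: mult_exp_exp)
      then show ?thesis using True by (simp add: ennreal_mult'[symmetric])
    qed simp
  qed
  also have "\<dots> = ennreal (exp (real (card K) * d)) * (\<integral>\<^sup>+z. ennreal (exp (- (h * (\<Sum>k\<in>K. (cmod (z k))\<^sup>2)))) \<partial>PiM K (\<lambda>_. complex_gaussian s))"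
    using K by (intro nn_integral_cmult) measurable
  also have "\<dots> = ennreal (exp (real (card K) * d) * (1 - d) ^ card K)"
    using d by (simp add: nn_integral_exp_norm_square[OF s K h] h2 ennreal_mult')
  also have "\<dots> \<le> ennreal (exp (real (card K) * d) * exp (- d - d\<^sup>2 / 2) ^ card K)"
    using d by (intro ennreal_leI mult_left_mono power_mono one_minus_le_exp) auto
  also have "exp (real (card K) * d) * exp (- d - d\<^sup>2 / 2) ^ card K = exp (- real (card K) * d\<^sup>2 / 2)"
    by (simp add: exp_of_nat_mult[symmetric] mult_exp_exp algebra_simps)
  finally show ?thesis .
qed

text \<open>Agreement is checked on product sets. For fixed real parts \<open>x\<close> the section
  in the imaginary parts is again a product, of the sets \<open>B k (x k)\<close>, so the
  coordinates decouple.\<close>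

lemma distr_Complex_gaussian_vectors:
  assumes s: "0 < s" and K: "finite K"
  defines "T \<equiv> PiM K (\<lambda>_::'i. density lborel (normal_density 0 s))"
  shows "distr (T \<Otimes>\<^sub>M T) (PiM K (\<lambda>_. borel)) (\<lambda>(x, y). \<lambda>k\<in>K. Complex (x k) (y k)) = PiM K (\<lambda>_. complex_gaussian s)"
proof -
  let ?N = "density lborel (normal_density 0 s)"
  interpret N: prob_space ?N by (rule prob_space_normal[OF s])
  interpret T: prob_space T unfolding T_def by (rule prob_space_PiM) (rule prob_space_normal[OF s])
  interpret TT: pair_sigma_finite T T ..
  interpret NN: pair_sigma_finite ?N ?N ..
  interpret product_sigma_finite "\<lambda>_::'i. complex_gaussian s" by (rule product_sigma_finite_complex_gaussian[OF s])
  interpret NP: product_sigma_finite "\<lambda>_::'i. ?N"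
    unfolding product_sigma_finite_def by (auto intro: N.sigma_finite_measure_axioms)
  have setsT [measurable_cong]: "sets T = sets (PiM K (\<lambda>_. borel))"
    unfolding T_def by (intro sets_PiM_cong) auto
  have m [measurable]: "(\<lambda>(x, y). \<lambda>k\<in>K. Complex (x k) (y k)) \<in> measurable (T \<Otimes>\<^sub>M T) (PiM K (\<lambda>_. borel))"
    unfolding Complex_eq by measurable
  show ?thesis
  proof (rule PiM_eqI[OF K])
    show "sets (distr (T \<Otimes>\<^sub>M T) (PiM K (\<lambda>_. borel)) (\<lambda>(x, y). \<lambda>k\<in>K. Complex (x k) (y k))) = sets (PiM K (\<lambda>_. complex_gaussian s))"
      by (simp, intro sets_PiM_cong) auto
    fix A assume A: "\<And>i. i \<in> K \<Longrightarrow> A i \<in> sets (complex_gaussian s)"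
    define B where "B k a = {b. Complex a b \<in> A k}" for k a
    have Am: "A k \<in> sets borel" if "k \<in> K" for k using A[OF that] by simp
    have B2: "{(a, b). Complex a b \<in> A k} \<in> sets (borel \<Otimes>\<^sub>M borel)" if "k \<in> K" for k
      using measurable_sets[OF Complex_measurable Am[OF that]] by (simp add: vimage_def space_pair_measure split_def)
    have Bm: "B k a \<in> sets borel" if "k \<in> K" for k a
      using sets_Pair1[OF B2[OF that], of a] by (simp add: B_def vimage_def)
    have AE: "PiE K A \<in> sets (PiM K (\<lambda>_. borel))" using Am by (intro sets_PiM_I_finite K) auto
    define V where "V = (\<lambda>(x, y). \<lambda>k\<in>K. Complex (x k) (y k)) -` PiE K A \<inter> space (T \<Otimes>\<^sub>M T)"
    have V: "V \<in> sets (T \<Otimes>\<^sub>M T)" unfolding V_def using m AE by (rule measurable_sets)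
    have "emeasure (distr (T \<Otimes>\<^sub>M T) (PiM K (\<lambda>_. borel)) (\<lambda>(x, y). \<lambda>k\<in>K. Complex (x k) (y k))) (PiE K A) = emeasure (T \<Otimes>\<^sub>M T) V"
      unfolding V_def using m AE by (rule emeasure_distr)
    also have "\<dots> = (\<integral>\<^sup>+x. emeasure T (Pair x -` V) \<partial>T)"
      by (rule T.emeasure_pair_measure_alt[OF V])
    also have "\<dots> = (\<integral>\<^sup>+x. (\<Prod>k\<in>K. emeasure ?N (B k (x k))) \<partial>T)"
    proof (rule nn_integral_cong)
      fix x assume "x \<in> space T"
      then have "Pair x -` V = PiE K (\<lambda>k. B k (x k))"
        by (auto simp: V_def B_def space_pair_measure T_def space_PiM PiE_iff)
      then show "emeasure T (Pair x -` V) = (\<Prod>k\<in>K. emeasure ?N (B k (x k)))"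
        unfolding T_def using Bm by (simp add: NP.emeasure_PiM[OF K])
    qed
    also have "\<dots> = (\<Prod>k\<in>K. \<integral>\<^sup>+a. emeasure ?N (B k a) \<partial>?N)"
    proof -
      have "(\<lambda>a. emeasure ?N (B k a)) \<in> borel_measurable ?N" if "k \<in> K" for k
      proof -
        have "{(a, b). Complex a b \<in> A k} \<in> sets (?N \<Otimes>\<^sub>M ?N)"
          using B2[OF that] by (simp cong: sets_pair_measure_cong)
        from N.measurable_emeasure_Pair[OF this] show ?thesis by (simp add: B_def vimage_def)
      qed
      then show ?thesis unfolding T_def by (intro NP.product_nn_integral_prod K) auto
    qed
    also have "\<dots> = (\<Prod>k\<in>K. emeasure (complex_gaussian s) (A k))"
    proof (rule prod.cong[OF refl])
      fix k assume k: "k \<in> K"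
      have C: "{(a, b). Complex a b \<in> A k} \<in> sets (?N \<Otimes>\<^sub>M ?N)"
        using B2[OF k] by (simp cong: sets_pair_measure_cong)
      have "emeasure (complex_gaussian s) (A k) = emeasure (?N \<Otimes>\<^sub>M ?N) {(a, b). Complex a b \<in> A k}"
        unfolding complex_gaussian_def using Am[OF k]
        by (subst emeasure_distr) (auto simp: space_pair_measure vimage_def split_def)
      also have "\<dots> = (\<integral>\<^sup>+a. emeasure ?N (B k a) \<partial>?N)"
        by (subst N.emeasure_pair_measure_alt[OF C]) (simp add: B_def vimage_def)
      finally show "(\<integral>\<^sup>+a. emeasure ?N (B k a) \<partial>?N) = emeasure (complex_gaussian s) (A k)" ..
    qed
    finally show "emeasure (distr (T \<Otimes>\<^sub>M T) (PiM K (\<lambda>_. borel)) (\<lambda>(x, y). \<lambda>k\<in>K. Complex (x k) (y k))) (PiE K A) =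
      (\<Prod>k\<in>K. emeasure (complex_gaussian s) (A k))" .
  qed
qed

section \<open>The CBLasso\<close>

lemma freqs_eq_image: "freqs fc = (\<lambda>j. int j - int fc) ` {..<2 * fc + 1}"
proof
  show "freqs fc \<subseteq> (\<lambda>j. int j - int fc) ` {..<2 * fc + 1}"
  proof
    fix k assume "k \<in> freqs fc"
    then have "k = int (nat (k + int fc)) - int fc" "nat (k + int fc) < 2 * fc + 1" by (auto simp: freqs_def)
    then show "k \<in> (\<lambda>j. int j - int fc) ` {..<2 * fc + 1}" by blast
  qed
qed (auto simp: freqs_def)

lemma inj_freqs: "inj_on (\<lambda>j. int j - int fc) S"
  by (auto simp: inj_on_def)

lemma finite_freqs [simp]: "finite (freqs fc)"
  by (simp add: freqs_eq_image)

lemma card_freqs [simp]: "card (freqs fc) = 2 * fc + 1"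
  unfolding freqs_eq_image by (subst card_image[OF inj_freqs]) simp

lemma zero_in_freqs [simp]: "0 \<in> freqs fc"
  by (simp add: freqs_def)

lemma l2_norm_nonneg [simp]: "0 \<le> l2_norm fc v"
  by (simp add: l2_norm_def sum_nonneg)

lemma l2_norm_square: "(l2_norm fc v)\<^sup>2 = (\<Sum>k\<in>freqs fc. (cmod (v k))\<^sup>2)"
  by (simp add: l2_norm_def sum_nonneg)

lemma l2_norm_Cauchy_Schwarz: "(\<Sum>k\<in>freqs fc. Re (cnj (u k) * v k)) \<le> l2_norm fc u * l2_norm fc v"
proof -
  have "(\<Sum>k\<in>freqs fc. Re (cnj (u k) * v k)) \<le> (\<Sum>k\<in>freqs fc. \<bar>cmod (u k)\<bar> * \<bar>cmod (v k)\<bar>)"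
    by (intro sum_mono order_trans[OF complex_Re_le_cmod]) (simp add: norm_mult)
  also have "\<dots> \<le> l2_norm fc u * l2_norm fc v"
    unfolding l2_norm_def L2_set_def[symmetric] by (rule L2_set_mult_ineq)
  finally show ?thesis .
qed

text \<open>Multiplication by the unimodular \<open>cis (fc * a)\<close> shifts the frequencies from
  \<open>- fc\<close> to \<open>fc\<close> onto the exponents 0 to \<open>2 * fc\<close> of a
  polynomial.\<close>

lemma norm_trig_poly_le_oversampled_max:
  assumes n: "n = 2 * fc + 1" and "n \<le> N"
    and L: "\<And>j. j < N \<Longrightarrow> (cmod (\<Sum>k\<in>freqs fc. v k * cis (of_int k * (2 * pi * real j / real N))))\<^sup>2 \<le> L"
  shows "(cmod (\<Sum>k\<in>freqs fc. v k * cnj (fourier_char k t)))\<^sup>2 \<le> real N / real (N - n + 1) * L"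
proof -
  define p :: "complex poly" where "p = (\<Sum>j<n. monom (v (int j - int fc)) j)"
  have "degree p \<le> n - 1"
    by (rule degree_le) (auto simp: p_def coeff_sum n intro!: sum.neutral)
  then have dp: "degree p < n" using n by simp
  have p: "cmod (poly p (cis a)) = cmod (\<Sum>k\<in>freqs fc. v k * cis (of_int k * a))" for a
  proof -
    have "poly p (cis a) = (\<Sum>j<n. v (int j - int fc) * cis a ^ j)"
      by (simp add: p_def poly_sum poly_monom)
    also have "\<dots> = (\<Sum>j<n. cis (real fc * a) * (v (int j - int fc) * cis (of_int (int j - int fc) * a)))"
      by (intro sum.cong refl) (simp add: Complex.DeMoivre cis_mult mult.left_commute left_diff_distrib)
    also have "\<dots> = cis (real fc * a) * (\<Sum>k\<in>freqs fc. v k * cis (of_int k * a))"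
      unfolding freqs_eq_image n by (subst sum.reindex[OF inj_freqs]) (simp only: comp_def sum_distrib_left)
    finally show ?thesis by (simp add: norm_mult)
  qed
  obtain r where t: "t = torus_of r" by (induction t rule: torus.abs_induct) auto
  have "cnj (fourier_char k t) = cis (of_int k * (2 * pi * r))" for k
    by (simp add: t fourier_char_torus_of cis_cnj mult_ac)
  then have "cmod (\<Sum>k\<in>freqs fc. v k * cnj (fourier_char k t)) = cmod (poly p (cis (2 * pi * r)))"
    by (simp add: p)
  then show ?thesis
    using norm_poly_le_oversampled_max[OF dp \<open>n \<le> N\<close>, of "cis (2 * pi * r)" L] L by (simp add: p)
qed

section \<open>Reduction to the square-root Lasso and the deterministic bound\<close>

lemma cblasso_objective_pos:
  assumes "0 < \<sigma>"
  shows "cblasso_objective fc lam y (\<mu>, \<sigma>) =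
    ereal ((l2_norm fc (\<lambda>k. y k - fourier_coeff \<mu> k) / sqrt (real (2 * fc + 1)))\<^sup>2 / (2 * \<sigma>) + \<sigma> / 2 + lam * tv_norm \<mu>)"
  using assms by (simp add: cblasso_objective_def power_divide mult_ac)

lemma cblasso_minimizer_le:
  assumes "cblasso_minimizer fc lam y (\<mu>h, \<sigma>h)" "\<mu> \<in> complex_borel_measures" "0 \<le> \<sigma>"
  shows "cblasso_objective fc lam y (\<mu>h, \<sigma>h) \<le> cblasso_objective fc lam y (\<mu>, \<sigma>)"
  using assms unfolding cblasso_minimizer_def is_arg_min_def by (auto simp: not_less)

text \<open>Minimising over \<open>\<sigma>\<close> first turns the problem into the square-root Lasso
  \<open>min r(\<mu>) + \<lambda> \<parallel>\<mu>\<parallel>\<close>, with \<open>r\<close> the normalised residual norm.\<close>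

lemma cblasso_minimizer_residual:
  fixes fc :: nat and lam :: real and y :: "int \<Rightarrow> complex"
  defines "r \<equiv> \<lambda>\<mu>. l2_norm fc (\<lambda>k. y k - fourier_coeff \<mu> k) / sqrt (real (2 * fc + 1))"
  assumes min: "cblasso_minimizer fc lam y (\<mu>h, \<sigma>h)"
    and \<mu>: "\<mu> \<in> complex_borel_measures" "0 < r \<mu>"
  shows "\<sigma>h = r \<mu>h" "\<sigma>h + lam * tv_norm \<mu>h \<le> r \<mu> + lam * tv_norm \<mu>"
proof -
  have h: "\<mu>h \<in> complex_borel_measures" "0 \<le> \<sigma>h"
    using min by (auto simp: cblasso_minimizer_def is_arg_min_def)
  have obj: "cblasso_objective fc lam y (\<mu>', \<sigma>) = ereal ((r \<mu>')\<^sup>2 / (2 * \<sigma>) + \<sigma> / 2 + lam * tv_norm \<mu>')"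
    if "0 < \<sigma>" for \<mu>' \<sigma>
    unfolding r_def by (rule cblasso_objective_pos[OF that])
  have r0: "0 \<le> r \<mu>'" for \<mu>' by (simp add: r_def)
  \<comment> \<open>At \<open>\<sigma> = r \<mu>\<close> both \<sigma>-dependent terms equal
    \<open>r \<mu> / 2\<close>; positivity of \<open>r \<mu>\<close> selects the first branch of the
    objective.\<close>
  have "cblasso_objective fc lam y (\<mu>, r \<mu>) = ereal (r \<mu> + lam * tv_norm \<mu>)"
    using \<mu>(2) by (simp add: obj power2_eq_square)
  then have le: "cblasso_objective fc lam y (\<mu>h, \<sigma>h) \<le> ereal (r \<mu> + lam * tv_norm \<mu>)"
    using cblasso_minimizer_le[OF min \<mu>(1), of "r \<mu>"] \<mu>(2) by simp
  have "\<sigma>h = r \<mu>h \<and> cblasso_objective fc lam y (\<mu>h, \<sigma>h) = ereal (\<sigma>h + lam * tv_norm \<mu>h)"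
  proof (cases "\<sigma>h > 0")
    case True
    have opt: "(r \<mu>h)\<^sup>2 / (2 * \<sigma>h) + \<sigma>h / 2 \<le> (r \<mu>h)\<^sup>2 / (2 * \<sigma>) + \<sigma> / 2" if "0 < \<sigma>" for \<sigma>
      using cblasso_minimizer_le[OF min h(1), of \<sigma>] that True by (simp add: obj)
    have "r \<mu>h > 0"
    proof (rule ccontr)
      assume "\<not> r \<mu>h > 0"
      then have "r \<mu>h = 0" using r0[of \<mu>h] by simp
      \<comment> \<open>With zero residual, halving \<open>\<sigma>h\<close> would lower the
        objective.\<close>
      then show False using opt[of "\<sigma>h / 2"] True by simp
    qed
    \<comment> \<open>Comparison with \<open>\<sigma> = r \<mu>h\<close> reverses the
      arithmetic-geometric mean inequality, so its equality case holds.\<close>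
    then have "(r \<mu>h)\<^sup>2 / (2 * \<sigma>h) + \<sigma>h / 2 \<le> r \<mu>h"
      using opt[of "r \<mu>h"] by (simp add: power2_eq_square)
    then have "(r \<mu>h)\<^sup>2 + \<sigma>h\<^sup>2 \<le> 2 * \<sigma>h * r \<mu>h" using True by (simp add: field_simps power2_eq_square)
    then have "(r \<mu>h - \<sigma>h)\<^sup>2 \<le> 0" by (simp add: power2_diff mult_ac)
    then have "\<sigma>h = r \<mu>h" by simp
    then show ?thesis using True by (simp add: obj power2_eq_square)
  next
    case False
    then have 0: "\<sigma>h = 0" using h by simp
    \<comment> \<open>By \<open>le\<close> the objective is finite, and at
      \<open>\<sigma>h = 0\<close> this forces an exact fit.\<close>
    have "\<forall>k\<in>freqs fc. y k = fourier_coeff \<mu>h k"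
      using le 0 by (auto simp: cblasso_objective_def split: if_splits)
    then show ?thesis using 0 by (simp add: cblasso_objective_def r_def l2_norm_def)
  qed
  then show "\<sigma>h = r \<mu>h" "\<sigma>h + lam * tv_norm \<mu>h \<le> r \<mu> + lam * tv_norm \<mu>" using le by auto
qed

lemma cblasso_noise_level_bound:
  fixes fc n :: nat and lam \<eta> R E :: real and v y :: "int \<Rightarrow> complex"
  defines "E \<equiv> l2_norm fc v"
  assumes n: "n = 2 * fc + 1"
    and \<mu>0: "\<mu>0 \<in> complex_borel_measures" and y: "\<And>k. y k = fourier_coeff \<mu>0 k + v k"
    and min: "cblasso_minimizer fc lam y (\<mu>h, \<sigma>h)"
    and lam: "0 < lam" and \<eta>: "0 < \<eta>" "\<eta> < 1" and E: "0 < E" and R: "0 < R" "R \<le> (1 - \<eta>) * lam"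
    and dual: "\<And>t. cmod (\<Sum>k\<in>freqs fc. v k * cnj (fourier_char k t)) \<le> R * sqrt (real n) * E"
    and small: "lam * tv_norm \<mu>0 * sqrt (real n) / E \<le> 2 * (sqrt (1 + (\<eta> / 2)\<^sup>2) - 1)"
  shows "\<bar>sqrt (real n) * \<sigma>h / E - 1\<bar> \<le> \<eta>"
proof -
  have \<mu>h: "\<mu>h \<in> complex_borel_measures"
    using min by (auto simp: cblasso_minimizer_def is_arg_min_def)
  define e where "e = E / sqrt (real n)"
  have n0: "0 < sqrt (real n)" using n by simp
  have e: "0 < e" using E n0 by (simp add: e_def)
  have Ee: "E = sqrt (real n) * e" using n0 by (simp add: e_def)
  have r\<mu>0: "l2_norm fc (\<lambda>k. y k - fourier_coeff \<mu>0 k) / sqrt (real (2 * fc + 1)) = e"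
    by (simp add: y e_def E_def n)
  note res = cblasso_minimizer_residual[OF min \<mu>0, unfolded r\<mu>0, OF e, folded n]
  define th t0 where "th = tv_norm \<mu>h" and "t0 = tv_norm \<mu>0"
  have t: "0 \<le> th" "0 \<le> t0" by (simp_all add: th_def t0_def tv_norm_nonneg \<mu>h \<mu>0)
  have pair: "\<bar>\<Sum>k\<in>freqs fc. Re (cnj (v k) * fourier_coeff \<mu> k)\<bar> \<le> R * sqrt (real n) * E * tv_norm \<mu>"
    if "\<mu> \<in> complex_borel_measures" for \<mu>
    unfolding fourier_coeff_def using R E n0
    by (intro complex_integral_pairing_le[OF that] continuous_on_fourier_char dual) auto
  \<comment> \<open>The residual of \<open>\<mu>h\<close> is the noise plus the Fourier coefficients
    of \<open>\<mu>0\<close> minus those of \<open>\<mu>h\<close>; paired with the noise, both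
    coefficient terms are controlled by duality.\<close>
  have "E\<^sup>2 - R * sqrt (real n) * E * (th + t0) \<le>
      E\<^sup>2 + (\<Sum>k\<in>freqs fc. Re (cnj (v k) * fourier_coeff \<mu>0 k)) - (\<Sum>k\<in>freqs fc. Re (cnj (v k) * fourier_coeff \<mu>h k))"
    using pair[OF \<mu>h] pair[OF \<mu>0] unfolding th_def t0_def abs_le_iff distrib_left by linarith
  also have "\<dots> = (\<Sum>k\<in>freqs fc. Re (cnj (v k) * (y k - fourier_coeff \<mu>h k)))"
    unfolding E_def l2_norm_square y sum.distrib[symmetric] sum_subtractf[symmetric]
    by (intro sum.cong refl, unfold cmod_power2) (simp add: power2_eq_square algebra_simps)
  also have "\<dots> \<le> E * (sqrt (real n) * \<sigma>h)"
    using l2_norm_Cauchy_Schwarz[of v "\<lambda>k. y k - fourier_coeff \<mu>h k" fc] n0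
    unfolding res(1) E_def by simp
  finally have "E * (sqrt (real n) * (e - R * (th + t0))) \<le> E * (sqrt (real n) * \<sigma>h)"
    by (simp add: Ee power2_eq_square algebra_simps)
  then have low: "e - R * (th + t0) \<le> \<sigma>h" using E n0 by simp
  have "R * (th + t0) \<le> (1 - \<eta>) * lam * (th + t0)" using R t by (intro mult_right_mono) auto
  with low have low': "e - (1 - \<eta>) * lam * (th + t0) \<le> \<sigma>h" by simp
  have up: "\<sigma>h + lam * th \<le> e + lam * t0" using res(2) by (simp add: th_def t0_def)
  \<comment> \<open>Combining the two bounds eliminates both \<open>\<sigma>h\<close> and
    \<open>e\<close>.\<close>
  have "lam * th \<le> lam * t0 + (1 - \<eta>) * lam * (th + t0)" using low' up by linarith
  then have "lam * (\<eta> * (th + t0)) \<le> lam * (2 * t0)" by (simp add: algebra_simps)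
  then have tt: "\<eta> * (th + t0) \<le> 2 * t0" using lam by simp
  have aux: "a \<le> 2 * (x - 1) \<Longrightarrow> x \<le> 1 + q / 2 \<Longrightarrow> a \<le> q" for a x q :: real by simp
  \<comment> \<open>The tangent bound for the root turns the smallness assumption into
    \<open>lam * t0 / e \<le> \<eta>\<^sup>2 / 4\<close>.\<close>
  have "sqrt (1 + (\<eta> / 2)\<^sup>2) \<le> 1 + (\<eta> / 2)\<^sup>2 / 2" using \<eta>
    by (intro real_le_lsqrt) (auto simp: power2_eq_square algebra_simps)
  then have "lam * tv_norm \<mu>0 * sqrt (real n) / E \<le> (\<eta> / 2)\<^sup>2" by (rule aux[OF small])
  also have "lam * tv_norm \<mu>0 * sqrt (real n) / E = lam * t0 / e" by (simp add: e_def t0_def)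
  also have "(\<eta> / 2)\<^sup>2 = \<eta>\<^sup>2 / 4" by (simp add: power_divide)
  finally have "lam * t0 / e \<le> \<eta>\<^sup>2 / 4" .
  then have lt: "lam * t0 \<le> \<eta>\<^sup>2 / 4 * e" using e by (simp add: field_simps)
  have \<eta>2: "\<eta>\<^sup>2 \<le> \<eta>" using \<eta> by (simp add: power2_eq_square mult_left_le)
  have "0 \<le> lam * th" using lam t by simp
  have "\<sigma>h \<le> e + lam * t0" using up \<open>0 \<le> lam * th\<close> by linarith
  also have "lam * t0 \<le> \<eta> * e"
  proof -
    have "\<eta>\<^sup>2 / 4 * e \<le> \<eta> * e" using \<eta>2 \<eta> e by (intro mult_right_mono) auto
    with lt show ?thesis by linarith
  qed
  finally have 1: "\<sigma>h - e \<le> \<eta> * e" by simp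
  \<comment> \<open>The extra factor \<eta> makes \<open>tt\<close> applicable as it stands; it is
    cancelled at the end.\<close>
  have "\<eta> * (e - \<sigma>h) \<le> \<eta> * ((1 - \<eta>) * lam * (th + t0))" using low' \<eta> by (intro mult_left_mono) auto
  also have "\<dots> = (1 - \<eta>) * lam * (\<eta> * (th + t0))" by simp
  also have "\<dots> \<le> (1 - \<eta>) * lam * (2 * t0)" using tt \<eta> lam by (intro mult_left_mono) auto
  also have "\<dots> = (1 - \<eta>) * (2 * (lam * t0))" by simp
  also have "\<dots> \<le> 1 * (2 * (lam * t0))" using \<eta> lam t by (intro mult_right_mono) auto
  also have "\<dots> \<le> \<eta>\<^sup>2 / 2 * e" using lt by simp
  also have "\<dots> \<le> \<eta>\<^sup>2 * e" using \<eta> e by (intro mult_right_mono) auto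
  also have "\<dots> = \<eta> * (\<eta> * e)" by (simp add: power2_eq_square)
  finally have 2: "e - \<sigma>h \<le> \<eta> * e" using \<eta> by simp
  have "\<bar>\<sigma>h - e\<bar> \<le> \<eta> * e" using 1 2 by linarith
  then have "\<bar>\<sigma>h / e - 1\<bar> \<le> \<eta>" using e by (simp add: field_simps abs_le_iff)
  moreover have "sqrt (real n) * \<sigma>h / E = \<sigma>h / e" using n0 by (simp add: e_def)
  ultimately show ?thesis by simp
qed

section \<open>The law of the noise and the probability estimate\<close>

lemma distr_complex_gaussian_vector:
  fixes X Y :: "'w \<Rightarrow> 'i \<Rightarrow> real"
  assumes M: "prob_space M" and s: "0 < s" and K: "finite K"
    and X: "isotropic_gaussian_vector M K s X" and Y: "isotropic_gaussian_vector M K s Y"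
    and indep: "prob_space.indep_var M (PiM K (\<lambda>_. borel)) X (PiM K (\<lambda>_. borel)) Y"
  shows "(\<lambda>\<omega>. \<lambda>k\<in>K. Complex (X \<omega> k) (Y \<omega> k)) \<in> measurable M (PiM K (\<lambda>_. borel))"
    and "distr M (PiM K (\<lambda>_. borel)) (\<lambda>\<omega>. \<lambda>k\<in>K. Complex (X \<omega> k) (Y \<omega> k)) = PiM K (\<lambda>_. complex_gaussian s)"
proof -
  interpret prob_space M by (rule M)
  let ?B = "PiM K (\<lambda>_. borel :: real measure)"
  let ?T = "PiM K (\<lambda>_. density lborel (normal_density 0 s))"
  have XY [measurable]: "X \<in> measurable M ?B" "Y \<in> measurable M ?B"
    and dX: "distr M ?B X = ?T" and dY: "distr M ?B Y = ?T"
    using X Y by (auto simp: isotropic_gaussian_vector_def)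
  have C [measurable]: "(\<lambda>(x, y). \<lambda>k\<in>K. Complex (x k) (y k)) \<in> measurable (?B \<Otimes>\<^sub>M ?B) (PiM K (\<lambda>_. borel))"
    unfolding Complex_eq by measurable
  have P: "(\<lambda>\<omega>. (X \<omega>, Y \<omega>)) \<in> measurable M (?B \<Otimes>\<^sub>M ?B)" by measurable
  show "(\<lambda>\<omega>. \<lambda>k\<in>K. Complex (X \<omega> k) (Y \<omega> k)) \<in> measurable M (PiM K (\<lambda>_. borel))"
    using measurable_comp[OF P C] by (simp add: comp_def)
  have "?T \<Otimes>\<^sub>M ?T = distr M (?B \<Otimes>\<^sub>M ?B) (\<lambda>\<omega>. (X \<omega>, Y \<omega>))"
    using indep unfolding indep_var_distribution_eq dX dY by blast
  then have "PiM K (\<lambda>_. complex_gaussian s) =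
      distr (distr M (?B \<Otimes>\<^sub>M ?B) (\<lambda>\<omega>. (X \<omega>, Y \<omega>))) (PiM K (\<lambda>_. borel)) (\<lambda>(x, y). \<lambda>k\<in>K. Complex (x k) (y k))"
    using distr_Complex_gaussian_vectors[OF s K] by simp
  also have "\<dots> = distr M (PiM K (\<lambda>_. borel)) (\<lambda>\<omega>. \<lambda>k\<in>K. Complex (X \<omega> k) (Y \<omega> k))"
    by (subst distr_distr[OF C P]) (simp add: comp_def)
  finally show "distr M (PiM K (\<lambda>_. borel)) (\<lambda>\<omega>. \<lambda>k\<in>K. Complex (X \<omega> k) (Y \<omega> k)) = PiM K (\<lambda>_. complex_gaussian s)" ..
qed

text \<open>The event of small noise norm has probability at most \<open>\<alpha>\<close>, and each of the \<open>4 n\<close> grid points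
  contributes at most \<open>exp (- 3/2 * ln (n / \<alpha>)) = (\<alpha> / n) powr (3 / 2)\<close>.\<close>

lemma probability_budget:
  fixes n \<alpha> :: real
  defines "C \<equiv> 2 * sqrt 2 / n + (2 * sqrt 3 + 3) / 3"
  assumes n: "3 \<le> n" and \<alpha>: "0 < \<alpha>" "\<alpha> * C \<le> 1"
  shows "2 \<le> ln (n / \<alpha>)" "\<alpha> + 4 * n * exp (- (3 / 2 * ln (n / \<alpha>))) < \<alpha> * C"
proof -
  \<comment> \<open>Rational bounds on the two roots, just sharp enough for
    \<open>C \<ge> 2.15 + 2.8 / n\<close>.\<close>
  have "7 / 5 \<le> sqrt 2" "173 / 100 \<le> sqrt 3"
    by (rule real_le_rsqrt, simp add: power2_eq_square)+
  then have "2.8 \<le> 2 * sqrt 2" and "2.15 \<le> (2 * sqrt 3 + 3) / 3" by simp_all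
  then have "2.8 / n + 2.15 \<le> C" unfolding C_def using n by (intro add_mono divide_right_mono) auto
  then have C: "2.15 + 2.8 / n \<le> C" by (simp only: add.commute)
  have nC: "2.15 * n + 2.8 \<le> n * C" using mult_left_mono[OF C, of n] n by (simp add: algebra_simps)
  have L: "n * C \<le> n / \<alpha>" using \<alpha> n by (simp add: field_simps)
  \<comment> \<open>For \<open>n \<ge> 3\<close> one has
    \<open>n / \<alpha> \<ge> 2.15 * n + 2.8 \<ge> 9.25\<close>, while
    \<open>exp 2 \<le> 9\<close>.\<close>
  have "exp 2 = exp 1 * exp (1::real)" by (simp add: mult_exp_exp)
  also have "\<dots> \<le> 3 * 3" by (intro mult_mono exp_le) auto
  also have "\<dots> \<le> 2.15 * n + 2.8" using n by simp
  also note nC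
  also note L
  finally show "2 \<le> ln (n / \<alpha>)" using n \<alpha> by (simp add: ln_ge_iff)
  define q where "q = n / \<alpha>"
  have q: "0 < q" using n \<alpha> by (simp add: q_def)
  have "exp (- (3 / 2 * ln q)) = 1 / (q * sqrt q)"
  proof -
    have "exp (3 / 2 * ln q) = exp (ln q) * exp (ln q / 2)" by (simp add: mult_exp_exp)
    also have "exp (ln q / 2) = sqrt q" using q by (simp add: ln_sqrt[symmetric])
    finally show ?thesis using q by (simp add: exp_minus field_simps)
  qed
  then have eq: "4 * n * exp (- (3 / 2 * ln (n / \<alpha>))) = \<alpha> * (4 / sqrt q)"
    using n \<alpha> by (simp add: q_def field_simps)
  have "0 \<le> 2.8 / n" using n by simp
  then have C0: "2.15 \<le> C" using C by linarith
  have C1: "1.15 + 2.8 / n \<le> C - 1" using C by simp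
  \<comment> \<open>After division by \<alpha> the claim is \<open>16 < q * (C - 1)\<^sup>2\<close>,
    where \<open>q \<ge> n * C\<close>. The constants come from squaring
    \<open>1.15 + 2.8 / n\<close> and dropping the last term.\<close>
  have "16 < 2.15 * (1.3225 * n + 6.44)" using n by simp
  also have "\<dots> \<le> n * (2.15 * (1.15 + 2.8 / n)\<^sup>2)"
    using n by (simp add: power2_eq_square field_simps)
  also have "\<dots> \<le> n * (C * (C - 1)\<^sup>2)"
    using C0 C1 n by (intro mult_left_mono mult_mono power_mono) auto
  also have "\<dots> \<le> q * (C - 1)\<^sup>2" unfolding q_def mult.assoc[symmetric] using L by (rule mult_right_mono) simp
  finally have "sqrt 16 < sqrt (q * (C - 1)\<^sup>2)" by (rule real_sqrt_less_mono)
  moreover have "0 \<le> C - 1" using C0 by simp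
  ultimately have "4 < sqrt q * (C - 1)" by (simp add: real_sqrt_mult)
  then have "4 / sqrt q < C - 1" using q by (simp add: field_simps)
  then have "\<alpha> * (4 / sqrt q) < \<alpha> * (C - 1)" using \<alpha>(1) by (rule mult_strict_left_mono)
  then show "\<alpha> + 4 * n * exp (- (3 / 2 * ln (n / \<alpha>))) < \<alpha> * C"
    unfolding eq by (simp add: algebra_simps)
qed

theorem proposition4:
  fixes fc s0 n :: nat
    and \<sigma>0 \<eta> \<alpha> lam \<sigma>low R :: real
    and a0 :: "nat \<Rightarrow> complex" and t0 :: "nat \<Rightarrow> torus"
    and \<mu>0 :: "torus set \<Rightarrow> complex"
    and M :: "'w measure"
    and \<epsilon>1 \<epsilon>2 :: "'w \<Rightarrow> int \<Rightarrow> real"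
    and \<epsilon> y :: "'w \<Rightarrow> int \<Rightarrow> complex"
    and \<mu>hat :: "'w \<Rightarrow> torus set \<Rightarrow> complex" and \<sigma>hat :: "'w \<Rightarrow> real"
  assumes "fc \<ge> 1" and n: "n = 2 * fc + 1"
    and "\<sigma>0 > 0"
    and "s0 \<ge> 1" and \<mu>0: "\<mu>0 = (\<lambda>A. \<Sum>j = 1..s0. a0 j * dirac (t0 j) A)"
    and "prob_space M"
    and "isotropic_gaussian_vector M (freqs fc) \<sigma>0 \<epsilon>1"
    and "isotropic_gaussian_vector M (freqs fc) \<sigma>0 \<epsilon>2"
    and "prob_space.indep_var M (PiM (freqs fc) (\<lambda>_. borel)) \<epsilon>1 (PiM (freqs fc) (\<lambda>_. borel)) \<epsilon>2"
    and \<epsilon>: "\<epsilon> = (\<lambda>\<omega> k. Complex (\<epsilon>1 \<omega> k) (\<epsilon>2 \<omega> k))"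
    and y: "y = (\<lambda>\<omega> k. fourier_coeff \<mu>0 k + \<epsilon> \<omega> k)"
    and "0 < \<eta>" "\<eta> < 1"
    and "0 < \<alpha>" "\<alpha> < 1" and "real n > - 2 * ln \<alpha>"
    and "lam > 0"
    and "\<And>\<omega>. \<omega> \<in> space M \<Longrightarrow> cblasso_minimizer fc lam (y \<omega>) (\<mu>hat \<omega>, \<sigma>hat \<omega>)"
    and \<sigma>low: "\<sigma>low = sqrt 2 * \<sigma>0 * sqrt (1 - sqrt (- 2 * ln \<alpha> / real n))"
    and R: "R = sqrt (2 * ln (real n / \<alpha>) / real n)"
    and "lam \<ge> R / (1 - \<eta>)"
    and "lam * (tv_norm \<mu>0 / \<sigma>low) \<le> 2 * (sqrt (1 + (\<eta> / 2)\<^sup>2) - 1)"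
  shows "\<exists>A \<in> sets M.
           A \<subseteq> {\<omega> \<in> space M. \<bar>sqrt (real n) * \<sigma>hat \<omega> / l2_norm fc (\<epsilon> \<omega>) - 1\<bar> \<le> \<eta>} \<and>
           measure M A > 1 - \<alpha> * (2 * sqrt 2 / real n + (2 * sqrt 3 + 3) / 3)"
proof -
  interpret prob_space M by fact
  define C where "C = 2 * sqrt 2 / real n + (2 * sqrt 3 + 3) / 3"
  show ?thesis
  proof (cases "\<alpha> * C \<le> 1")
    case False
    \<comment> \<open>The required lower bound on the probability is negative here, so the empty
      event serves.\<close>
    then show ?thesis by (intro bexI[of _ "{}"]) (auto simp: C_def)
  next
    case True
    define K where "K = freqs fc"
    have K: "finite K" "card K = n" "0 \<in> K" by (simp_all add: K_def n)
    have n3: "3 \<le> real n" using \<open>fc \<ge> 1\<close> n by simp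
    have n0: "0 < sqrt (real n)" using n3 by simp
    note budget = probability_budget[OF n3 \<open>0 < \<alpha>\<close> True[unfolded C_def], folded C_def]
    define \<Gamma> where "\<Gamma> = PiM K (\<lambda>_. complex_gaussian \<sigma>0)"
    \<comment> \<open>Points of the product space are extensional, so the noise is restricted to
      \<open>K\<close>.\<close>
    define Z where "Z = (\<lambda>\<omega>. \<lambda>k\<in>K. Complex (\<epsilon>1 \<omega> k) (\<epsilon>2 \<omega> k))"
    define q where "q z = (\<Sum>k\<in>K. (cmod (z k))\<^sup>2)" for z :: "int \<Rightarrow> complex"
    have Zm: "Z \<in> measurable M (PiM K (\<lambda>_. borel))" and Zd: "distr M (PiM K (\<lambda>_. borel)) Z = \<Gamma>"
      unfolding Z_def \<Gamma>_def K_def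
      by (intro distr_complex_gaussian_vector[OF \<open>prob_space M\<close> \<open>\<sigma>0 > 0\<close> finite_freqs] assms)+
    have setsG [measurable_cong]: "sets \<Gamma> = sets (PiM K (\<lambda>_. borel))"
      unfolding Zd[symmetric] by simp
    have q_Z: "q (Z \<omega>) = (l2_norm fc (\<epsilon> \<omega>))\<^sup>2" for \<omega>
      by (simp add: q_def Z_def l2_norm_square \<epsilon> K_def)
    \<comment> \<open>Chosen so that \<open>exp (- n * \<delta>\<^sup>2 / 2) = \<alpha>\<close>; the
      norm threshold with this \<delta> is \<open>n * \<sigma>low\<^sup>2\<close>.\<close>
    define \<delta> where "\<delta> = sqrt (- 2 * ln \<alpha> / real n)"
    have "0 < - 2 * ln \<alpha> / real n" using \<open>0 < \<alpha>\<close> \<open>\<alpha> < 1\<close> n3 by (simp add: divide_neg_pos)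
    moreover have "- 2 * ln \<alpha> / real n < 1" using \<open>real n > - 2 * ln \<alpha>\<close> n3 by (subst divide_less_eq_1_pos) auto
    ultimately have \<delta>: "0 \<le> \<delta>" "\<delta> < 1" "\<delta>\<^sup>2 = - 2 * ln \<alpha> / real n"
      by (simp_all add: \<delta>_def del: divide_minus_left mult_minus_left)
    have \<sigma>low': "\<sigma>low = sqrt 2 * \<sigma>0 * sqrt (1 - \<delta>)" unfolding \<sigma>low \<delta>_def ..
    have \<sigma>low0: "0 < \<sigma>low" using \<open>\<sigma>0 > 0\<close> \<delta> by (simp add: \<sigma>low')
    have \<sigma>low2: "real n * \<sigma>low\<^sup>2 = 2 * \<sigma>0\<^sup>2 * real n * (1 - \<delta>)"
      using \<delta> by (simp add: \<sigma>low' power_mult_distrib)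
    define l where "l = ln (real n / \<alpha>)"
    have l2: "2 \<le> l" using budget(1) by (simp add: l_def)
    \<comment> \<open>With \<open>N = 4 * n\<close> the oversampling factor is at most 4/3, and
      \<open>x\<close> is \<open>3/4 * R\<^sup>2\<close>, so that the two multiply to
      \<open>R\<^sup>2\<close>.\<close>
    define N where "N = 4 * n"
    define x where "x = 3 / 2 * l / real n"
    have x: "2 \<le> x * (real (card K) - 1)"
    proof -
      have "2 * real n \<le> 3 * (real n - 1)" using n3 by simp
      also have "\<dots> \<le> 3 / 2 * l * (real n - 1)" using l2 n3 by (intro mult_right_mono) auto
      finally show ?thesis using n3 by (simp add: x_def K field_simps)
    qed
    \<comment> \<open>Evaluation at the \<open>j\<close>-th grid point as a unit vector; its entry
      at frequency 0 is real and positive, as the projection tail requires.\<close>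
    define w where "w j k = cis (of_int k * (2 * pi * real j / real N)) / of_real (sqrt (real n))" for j :: nat and k :: int
    have w0: "w j 0 = of_real (1 / sqrt (real n))" for j by (simp add: w_def)
    have w1: "(\<Sum>k\<in>K. (cmod (w j k))\<^sup>2) = 1" for j
      using n3 by (simp add: w_def norm_divide power_divide K)
    define B0 where "B0 = {z. q z < 2 * \<sigma>0\<^sup>2 * real n * (1 - \<delta>)}"
    define B where "B j = {z. x * q z < (cmod (\<Sum>k\<in>K. w j k * z k))\<^sup>2}" for j
    have qm [measurable]: "q \<in> borel_measurable (PiM K (\<lambda>_. borel))" unfolding q_def by measurable
    \<comment> \<open>Events are described on all functions; intersecting with the extensional ones
      leaves their preimages under \<open>Z\<close> unchanged.\<close>
    have sets_event: "Z -` S \<inter> space M \<in> sets M" and prob_event: "emeasure M (Z -` S \<inter> space M) = (\<integral>\<^sup>+z. indicator S z \<partial>\<Gamma>)"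
      if "Measurable.pred (PiM K (\<lambda>_. borel)) (\<lambda>z. z \<in> S)" for S
    proof -
      let ?S = "S \<inter> space (PiM K (\<lambda>_. borel :: complex measure))"
      have S: "?S \<in> sets (PiM K (\<lambda>_. borel))"
      proof -
        have "?S = {z \<in> space (PiM K (\<lambda>_. borel)). z \<in> S}" by auto
        also have "\<dots> \<in> sets (PiM K (\<lambda>_. borel))" using that unfolding pred_def .
        finally show ?thesis .
      qed
      have eq: "Z -` S \<inter> space M = Z -` ?S \<inter> space M"
        using measurable_space[OF Zm] by auto
      show "Z -` S \<inter> space M \<in> sets M" unfolding eq using Zm S by (rule measurable_sets)
      have "emeasure M (Z -` S \<inter> space M) = emeasure \<Gamma> ?S"
        unfolding eq Zd[symmetric] by (rule emeasure_distr[OF Zm S, symmetric])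
      also have "\<dots> = (\<integral>\<^sup>+z. indicator ?S z \<partial>\<Gamma>)" using S by (simp add: setsG)
      also have "\<dots> = (\<integral>\<^sup>+z. indicator S z \<partial>\<Gamma>)"
        by (intro nn_integral_cong) (auto simp: sets_eq_imp_space_eq[OF setsG] split: split_indicator)
      finally show "emeasure M (Z -` S \<inter> space M) = (\<integral>\<^sup>+z. indicator S z \<partial>\<Gamma>)" .
    qed
    have mB0: "Measurable.pred (PiM K (\<lambda>_. borel)) (\<lambda>z. z \<in> B0)" unfolding B0_def mem_Collect_eq by measurable
    have mB: "Measurable.pred (PiM K (\<lambda>_. borel)) (\<lambda>z. z \<in> B j)" for j unfolding B_def mem_Collect_eq by measurable
    have pB0: "measure M (Z -` B0 \<inter> space M) \<le> \<alpha>"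
    proof -
      have "emeasure M (Z -` B0 \<inter> space M) \<le> ennreal (exp (- real n * \<delta>\<^sup>2 / 2))"
        unfolding prob_event[OF mB0] unfolding B0_def q_def \<Gamma>_def
        using gaussian_norm_lower_tail[OF \<open>\<sigma>0 > 0\<close> K(1) \<delta>(1,2)] by (simp only: K)
      also have "exp (- real n * \<delta>\<^sup>2 / 2) = \<alpha>" unfolding \<delta> using n3 \<open>0 < \<alpha>\<close> by simp
      finally show ?thesis using \<open>0 < \<alpha>\<close> by (simp add: emeasure_eq_measure)
    qed
    have pB: "measure M (Z -` B j \<inter> space M) \<le> exp (- (3 / 2 * l))" for j
    proof -
      have "emeasure M (Z -` B j \<inter> space M) \<le> ennreal (exp (- real (card K) * x))"
        unfolding prob_event[OF mB] unfolding B_def q_def \<Gamma>_def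
        by (rule gaussian_projection_tail_le_exp[OF \<open>\<sigma>0 > 0\<close> K(1,3) w0 _ w1 x]) simp
      also have "- real (card K) * x = - (3 / 2 * l)" using n3 by (simp add: K x_def)
      finally show ?thesis by (simp add: emeasure_eq_measure)
    qed
    define V0 V where "V0 = Z -` B0 \<inter> space M" and "V j = Z -` B j \<inter> space M" for j
    have V: "V0 \<in> sets M" "V j \<in> sets M" for j
      unfolding V0_def V_def by (rule sets_event[OF mB0] sets_event[OF mB])+
    \<comment> \<open>An event in terms of the noise alone. The target set involves
      \<open>\<sigma>hat\<close>, which is an arbitrary selection of minimisers and may fail to be
      measurable.\<close>
    define A where "A = space M - (V0 \<union> (\<Union>j<N. V j))"
    have bad: "V0 \<union> (\<Union>j<N. V j) \<in> sets M" using V by auto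
    have "measure M (V0 \<union> (\<Union>j<N. V j)) \<le> measure M V0 + measure M (\<Union>j<N. V j)"
      using V by (intro measure_Un_le) auto
    also have "measure M (\<Union>j<N. V j) \<le> (\<Sum>j<N. measure M (V j))"
      using V by (intro measure_UNION_le) auto
    also have "\<dots> \<le> (\<Sum>j<N. exp (- (3 / 2 * l)))" unfolding V_def by (intro sum_mono pB)
    also have "\<dots> = 4 * real n * exp (- (3 / 2 * l))" by (simp add: N_def)
    finally have "measure M (V0 \<union> (\<Union>j<N. V j)) \<le> \<alpha> + 4 * real n * exp (- (3 / 2 * l))"
      using pB0 by (simp add: V0_def)
    also have "\<dots> < \<alpha> * C" using budget(2) by (simp only: l_def)
    finally have pA: "measure M A > 1 - \<alpha> * C" unfolding A_def using prob_compl[OF bad] by simp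
    have "\<bar>sqrt (real n) * \<sigma>hat \<omega> / l2_norm fc (\<epsilon> \<omega>) - 1\<bar> \<le> \<eta>" if "\<omega> \<in> A" for \<omega>
    proof -
      define E where "E = l2_norm fc (\<epsilon> \<omega>)"
      have \<omega>: "\<omega> \<in> space M" "Z \<omega> \<notin> B0" and grid: "\<And>j. j < N \<Longrightarrow> Z \<omega> \<notin> B j"
        using that by (auto simp: A_def V0_def V_def)
      have "(sqrt (real n) * \<sigma>low)\<^sup>2 \<le> E\<^sup>2"
        using \<omega>(2) n3 unfolding B0_def mem_Collect_eq q_Z E_def by (simp add: power_mult_distrib \<sigma>low2)
      then have Elow: "sqrt (real n) * \<sigma>low \<le> E" by (rule power2_le_imp_le) (simp add: E_def)
      have E0: "0 < E" using Elow mult_pos_pos[OF n0 \<sigma>low0] by linarith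
      have R2: "R\<^sup>2 = 2 * l / real n" using l2 by (simp add: R l_def)
      have R0: "0 < R" using l2 n3 by (simp add: R l_def[symmetric])
      have dual: "cmod (\<Sum>k\<in>freqs fc. \<epsilon> \<omega> k * cnj (fourier_char k t)) \<le> R * sqrt (real n) * E" for t
      proof -
        have L: "(cmod (\<Sum>k\<in>freqs fc. \<epsilon> \<omega> k * cis (of_int k * (2 * pi * real j / real N))))\<^sup>2 \<le> real n * (x * E\<^sup>2)"
          if "j < N" for j
        proof -
          have "(\<Sum>k\<in>K. w j k * Z \<omega> k) = (\<Sum>k\<in>K. \<epsilon> \<omega> k * cis (of_int k * (2 * pi * real j / real N))) / of_real (sqrt (real n))"
            unfolding sum_divide_distrib by (intro sum.cong refl) (simp add: w_def Z_def \<epsilon> mult.commute)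
          then have "(cmod (\<Sum>k\<in>K. \<epsilon> \<omega> k * cis (of_int k * (2 * pi * real j / real N))))\<^sup>2 / real n =
              (cmod (\<Sum>k\<in>K. w j k * Z \<omega> k))\<^sup>2"
            by (simp add: norm_divide power_divide)
          also have "\<dots> \<le> x * E\<^sup>2"
            using grid[OF that] unfolding B_def mem_Collect_eq q_Z E_def not_less .
          finally show ?thesis using n3 by (simp only: K_def) (simp add: pos_divide_le_eq mult.commute)
        qed
        have "(cmod (\<Sum>k\<in>freqs fc. \<epsilon> \<omega> k * cnj (fourier_char k t)))\<^sup>2 \<le> real N / real (N - n + 1) * (real n * (x * E\<^sup>2))"
          by (rule norm_trig_poly_le_oversampled_max[OF n _ L]) (simp_all add: N_def)
        also have "\<dots> \<le> 4 / 3 * (real n * (x * E\<^sup>2))"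
          using l2 n3 by (intro mult_right_mono) (auto simp: N_def x_def field_simps)
        also have "\<dots> = (R * sqrt (real n) * E)\<^sup>2"
          using n3 by (simp add: power_mult_distrib R2 x_def)
        finally show ?thesis by (rule power2_le_imp_le) (use R0 E0 in simp)
      qed
      \<comment> \<open>Off \<open>V0\<close> the empirical level \<open>E / sqrt n\<close> is at
        least \<open>\<sigma>low\<close>, so the smallness assumption carries over to it.\<close>
      have "lam * tv_norm \<mu>0 * sqrt (real n) / E \<le> lam * (tv_norm \<mu>0 / \<sigma>low)"
      proof -
        have "sqrt (real n) / E \<le> 1 / \<sigma>low" using Elow E0 \<sigma>low0 by (simp add: field_simps)
        moreover have "0 \<le> lam * tv_norm \<mu>0"
          unfolding \<mu>0 using \<open>lam > 0\<close>
          by (intro mult_nonneg_nonneg tv_norm_nonneg sum_dirac_complex_borel_measure) simp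
        ultimately have "lam * tv_norm \<mu>0 * (sqrt (real n) / E) \<le> lam * tv_norm \<mu>0 * (1 / \<sigma>low)"
          by (rule mult_left_mono)
        then show ?thesis by simp
      qed
      also note assms(22)
      finally have small: "lam * tv_norm \<mu>0 * sqrt (real n) / E \<le> 2 * (sqrt (1 + (\<eta> / 2)\<^sup>2) - 1)" .
      show ?thesis
      proof (rule cblasso_noise_level_bound[OF n])
        show "\<mu>0 \<in> complex_borel_measures" unfolding \<mu>0 by (rule sum_dirac_complex_borel_measure)
        show "y \<omega> k = fourier_coeff \<mu>0 k + \<epsilon> \<omega> k" for k by (simp add: y)
        show "cblasso_minimizer fc lam (y \<omega>) (\<mu>hat \<omega>, \<sigma>hat \<omega>)" using \<omega>(1) by fact
        show "R \<le> (1 - \<eta>) * lam" using \<open>lam \<ge> R / (1 - \<eta>)\<close> \<open>\<eta> < 1\<close> by (simp add: field_simps)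
      qed (use dual small E0 R0 \<open>lam > 0\<close> \<open>0 < \<eta>\<close> \<open>\<eta> < 1\<close> in \<open>simp_all add: E_def\<close>)
    qed
    then show ?thesis
      using pA bad by (intro bexI[of _ A]) (auto simp: A_def C_def)
  qed
qed

end
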